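(* Let $1\le p<\infty$ and $\alpha>-1$. There exists a constant $C=C(p,\alpha)\ge 1$, depending only on $p$ and $\alpha$, such that for every analytic function $f:\mathbb{D}\to\mathbb{C}$, $$C^{-1}\,\|f-f(0)\|_{N_\alpha^p}^{p}\le \int_{\mathbb{D}}\bigl[\log\bigl(1+(1-|z|)|f'(z)|\bigr)\bigr]^{p}\,dA_\alpha(z)\le C\,\|f-f(0)\|_{N_\alpha^p}^{p},$$ where the quantities are understood in $[0,\infty]$.
   Context: $\mathbb{D}=\{z\in\mathbb{C}:|z|<1\}$ is the open unit disk. $dA(z)=dx\,dy/\pi$ is normalized area measure and $dA_\alpha(z)=(1+\alpha)(1-|z|^2)^\alpha\,dA(z)$. For an analytic function $h$ on $\mathbb{D}$, $\|h\|_{N_\alpha^p}=\left\{\int_{\mathbb{D}}[\log(1+|h(z)|)]^p\,dA_\alpha(z)\right\}^{1/p}\in[0,\infty]$ (this is not a norm in the usual sense; the notation is only for convenience). $f-f(0)$ denotes the function $z\mapsto f(z)-f(0)$. *)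

theory Defs
  imports "HOL-Complex_Analysis.Complex_Analysis"
begin

abbreviation unit_disk :: "complex set" where
  "unit_disk \<equiv> ball 0 1"

definition area_measure :: "complex measure" where
  "area_measure = density (restrict_space lborel unit_disk) (\<lambda>z. ennreal (1 / pi))"

definition weighted_area :: "real \<Rightarrow> complex measure" where
  "weighted_area \<alpha> =
     density area_measure (\<lambda>z. ennreal ((1 + \<alpha>) * (1 - (cmod z)\<^sup>2) powr \<alpha>))"

text \<open>
  Real powers on \<open>[0, \<infinity>]\<close>; used only for exponents \<open>r > 0\<close>, where \<open>\<infinity>\<close> to the power
  \<open>r\<close> is \<open>\<infinity>\<close> and \<open>0\<close> to the power \<open>r\<close> is \<open>0\<close>.
\<close>
definition ennreal_powr :: "ennreal \<Rightarrow> real \<Rightarrow> ennreal" where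
  "ennreal_powr x r = (if x = \<infinity> then \<infinity> else ennreal (enn2real x powr r))"

definition N_norm :: "real \<Rightarrow> real \<Rightarrow> (complex \<Rightarrow> complex) \<Rightarrow> ennreal" where
  "N_norm p \<alpha> h =
     ennreal_powr (\<integral>\<^sup>+ z. ennreal (ln (1 + cmod (h z)) powr p) \<partial>weighted_area \<alpha>) (1 / p)"

end

theory Submission
  imports Defs
begin

text \<open>
  Put \<open>g = f - f 0\<close>, \<open>u = ln (1 + |g|)\<close> and \<open>v z = ln (1 + (1 - |z|) |f' z|)\<close>. For analytic \<open>h\<close> and
  \<open>p \<ge> 1\<close> the function \<open>ln (1 + |h|)\<^sup>p\<close> is subharmonic, so its value at a point is bounded by its average
  over a disk of radius comparable to the distance to the unit circle. With Cauchy's estimate this bounds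
  \<open>v\<^sup>p\<close> by local averages of \<open>u\<^sup>p\<close>, which gives the upper estimate after exchanging integrals.
  Conversely, join \<open>z\<close> to \<open>0\<close> by a radial chain with steps of length about \<open>2\<^sup>j (1 - |z|)\<close>. Since
  \<open>ln (1 + \<Sum>a\<^sub>j) \<le> \<Sum>ln (1 + a\<^sub>j)\<close>, \<open>u z\<close> is at most a sum over \<open>j\<close> of terms controlled by averages of
  \<open>v\<close> at scale \<open>2\<^sup>j (1 - |z|)\<close>. Averaging at that scale is bounded on the weighted space with norm
  \<open>O(2 powr (- j (\<alpha> + 1)))\<close>, because only a boundary strip of relative width \<open>1 / 2\<^sup>j\<close> sees a given
  point; as \<open>\<alpha> + 1 > 0\<close>, a discrete Hardy inequality sums the series.
\<close>

section \<open>Subharmonicity of powers of the logarithm\<close>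

text \<open>The integrands are controlled only inside the disk. Cutting off with the indicator gives
  functions measurable on the whole plane, as Tonelli over \<open>lborel\<close> requires.\<close>

lemma borel_measurable_ennreal_indicator_ball:
  fixes \<phi> :: "complex \<Rightarrow> real"
  assumes "continuous_on (ball c r) \<phi>"
  shows "(\<lambda>z. ennreal (\<phi> z) * indicator (ball c r) z) \<in> borel_measurable borel"
proof -
  have "(\<lambda>z. indicator (ball c r) z *\<^sub>R \<phi> z) \<in> borel_measurable borel"
    using assms by (intro borel_measurable_continuous_on_indicator) auto
  then have "(\<lambda>z. ennreal (indicator (ball c r) z *\<^sub>R \<phi> z)) \<in> borel_measurable borel"
    by simp
  also have "(\<lambda>z. ennreal (indicator (ball c r) z *\<^sub>R \<phi> z)) = (\<lambda>z. ennreal (\<phi> z) * indicator (ball c r) z)"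
    by (auto simp: indicator_def)
  finally show ?thesis .
qed

lemma continuous_on_ln_one_plus_powr:
  fixes \<phi> :: "complex \<Rightarrow> real"
  assumes "continuous_on S \<phi>" "\<And>z. z \<in> S \<Longrightarrow> 0 \<le> \<phi> z" "0 < p"
  shows "continuous_on S (\<lambda>z. ln (1 + \<phi> z) powr p)"
proof -
  have "0 < 1 + \<phi> z" if "z \<in> S" for z using assms(2)[OF that] by linarith
  then show ?thesis
    using assms by (intro continuous_on_powr' continuous_on_ln continuous_on_add continuous_on_const) force+
qed

section \<open>Invariance of Lebesgue measure under translations and rotations\<close>

lemma nn_integral_lborel_translate:
  fixes F :: "'a::euclidean_space \<Rightarrow> ennreal"
  assumes [measurable]: "F \<in> borel_measurable borel"
  shows "(\<integral>\<^sup>+x. F (a + x) \<partial>lborel) = (\<integral>\<^sup>+x. F x \<partial>lborel)"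
proof -
  have "(\<integral>\<^sup>+x. F x \<partial>lborel) = (\<integral>\<^sup>+x. F x \<partial>distr lborel borel ((+) a))"
    by (simp add: lborel_distr_plus)
  also have "\<dots> = (\<integral>\<^sup>+x. F (a + x) \<partial>lborel)"
    by (subst nn_integral_distr) auto
  finally show ?thesis by simp
qed

text \<open>
  The uniqueness argument for Haar measure: both sides are compared through a double integral against
  the indicator of the unit disk, which is invariant under the rotation.
\<close>
lemma nn_integral_lborel_rotate:
  fixes F :: "complex \<Rightarrow> ennreal"
  assumes [measurable]: "F \<in> borel_measurable borel" and c: "cmod c = 1"
  shows "(\<integral>\<^sup>+x. F (c * x) \<partial>lborel) = (\<integral>\<^sup>+x. F x \<partial>lborel)"
proof -
  define b :: "complex \<Rightarrow> ennreal" where "b = indicator (ball 0 1)"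
  have [measurable]: "b \<in> borel_measurable borel" unfolding b_def by (rule borel_measurable_indicator) simp
  have B: "(\<integral>\<^sup>+x. b (w - x) \<partial>lborel) = ennreal pi" for w :: complex
  proof -
    have "(\<integral>\<^sup>+x. b (w - x) \<partial>lborel) = (\<integral>\<^sup>+x. indicator (ball w 1) x \<partial>lborel)"
      by (intro nn_integral_cong) (auto simp: b_def indicator_def dist_norm norm_minus_commute)
    also have "\<dots> = ennreal pi"
      by (simp add: emeasure_ball unit_ball_vol_2)
    finally show ?thesis .
  qed
  have B0: "(\<integral>\<^sup>+y. b (c * y) \<partial>lborel) = ennreal pi"
  proof -
    have "(\<integral>\<^sup>+y. b (c * y) \<partial>lborel) = (\<integral>\<^sup>+x. indicator (ball (0::complex) 1) x \<partial>lborel)"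
      using c by (intro nn_integral_cong) (auto simp: b_def indicator_def norm_mult)
    also have "\<dots> = ennreal pi"
      by (simp add: emeasure_ball unit_ball_vol_2)
    finally show ?thesis .
  qed
  have "ennreal pi * (\<integral>\<^sup>+y. F (c * y) \<partial>lborel) =
      (\<integral>\<^sup>+y. \<integral>\<^sup>+x. F (c * y) * b (c * y - x) \<partial>lborel \<partial>lborel)"
  proof -
    have "(\<integral>\<^sup>+x. F (c * y) * b (c * y - x) \<partial>lborel) = F (c * y) * ennreal pi" for y
      unfolding B[of "c * y", symmetric] by (rule nn_integral_cmult) measurable
    then show ?thesis by (simp add: nn_integral_multc) (rule mult.commute)
  qed
  also have "\<dots> = (\<integral>\<^sup>+x. \<integral>\<^sup>+y. F (c * y) * b (c * y - x) \<partial>lborel \<partial>lborel)"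
    by (intro lborel_pair.Fubini') measurable
  also have "\<dots> = (\<integral>\<^sup>+x. \<integral>\<^sup>+y. F (c * y + x) * b (c * y) \<partial>lborel \<partial>lborel)"
  proof (rule nn_integral_cong)
    fix x :: complex
    have c0: "c \<noteq> 0" using c by auto
    \<comment> \<open>The translation by \<open>x / c\<close> moves the offset \<open>x\<close> from
      \<open>b\<close> to \<open>F\<close>; the integral over \<open>x\<close> then no longer
      depends on \<open>y\<close>.\<close>
    have "(\<integral>\<^sup>+y. F (c * y) * b (c * y - x) \<partial>lborel)
      = (\<integral>\<^sup>+y. F (c * (x / c + y)) * b (c * (x / c + y) - x) \<partial>lborel)"
      by (subst nn_integral_lborel_translate[where a="x / c"]) auto
    also have "\<dots> = (\<integral>\<^sup>+y. F (c * y + x) * b (c * y) \<partial>lborel)"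
      using c0 by (simp add: distrib_left add.commute)
    finally show "(\<integral>\<^sup>+y. F (c * y) * b (c * y - x) \<partial>lborel)
        = (\<integral>\<^sup>+y. F (c * y + x) * b (c * y) \<partial>lborel)" .
  qed
  also have "\<dots> = (\<integral>\<^sup>+y. \<integral>\<^sup>+x. F (c * y + x) * b (c * y) \<partial>lborel \<partial>lborel)"
    by (intro lborel_pair.Fubini') measurable
  also have "\<dots> = (\<integral>\<^sup>+y. (\<integral>\<^sup>+x. F x \<partial>lborel) * b (c * y) \<partial>lborel)"
    by (simp add: nn_integral_multc nn_integral_lborel_translate)
  also have "\<dots> = ennreal pi * (\<integral>\<^sup>+x. F x \<partial>lborel)"
    by (simp add: nn_integral_cmult B0) (rule mult.commute)
  finally show ?thesis
    by (subst (asm) ennreal_mult_cancel_left) auto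
qed

section \<open>Approximation of boundary values by real parts of entire functions\<close>

text \<open>Only values on the unit circle are constrained. With \<open>c\<close> complex,
  \<open>Re (c * z ^ n)\<close> covers both the cosine and the sine term of frequency
  \<open>n\<close>.\<close>

inductive trig_polynomial :: "(complex \<Rightarrow> real) \<Rightarrow> bool" where
  monomial: "(\<And>z. cmod z = 1 \<Longrightarrow> f z = Re (c * z ^ n)) \<Longrightarrow> trig_polynomial f"
| add: "trig_polynomial f \<Longrightarrow> trig_polynomial g \<Longrightarrow> trig_polynomial (\<lambda>z. f z + g z)"

text \<open>\<open>Re x * Re y\<close> is half of \<open>Re (x * y) + Re (x * cnj y)\<close>. On the
  circle \<open>cnj z\<close> is \<open>1 / z\<close>, so the second term is again a monomial, of
  degree \<open>m - n\<close>, or of degree \<open>n - m\<close> after conjugation.\<close>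

lemma trig_polynomial_mult_monomial:
  assumes "\<And>z. cmod z = 1 \<Longrightarrow> f z = Re (a * z ^ m)" "\<And>z. cmod z = 1 \<Longrightarrow> g z = Re (b * z ^ n)"
  shows "trig_polynomial (\<lambda>z. f z * g z)"
proof -
  have prod: "Re x * Re y = Re (x * y / 2) + Re (x * cnj y / 2)" for x y :: complex
    by (simp add: field_simps)
  have "\<exists>d k. \<forall>z. cmod z = 1 \<longrightarrow> Re (a * z ^ m * cnj (b * z ^ n) / 2) = Re (d * z ^ k)"
  proof (cases "n \<le> m")
    case True
    have "a * z ^ m * cnj (b * z ^ n) / 2 = (a * cnj b / 2) * z ^ (m - n)" if "cmod z = 1" for z
    proof -
      have "z ^ m * cnj z ^ n = z ^ (m - n) * (z * cnj z) ^ n"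
        using True by (simp add: power_mult_distrib mult.assoc[symmetric] flip: power_add)
      also have "z * cnj z = 1"
        using that by (simp add: complex_norm_square[symmetric])
      finally show ?thesis by simp
    qed
    then show ?thesis by metis
  next
    case False
    have "Re (a * z ^ m * cnj (b * z ^ n) / 2) = Re ((b * cnj a / 2) * z ^ (n - m))" if "cmod z = 1" for z
    proof -
      have "z ^ n * cnj z ^ m = z ^ (n - m) * (z * cnj z) ^ m"
        using False by (simp add: power_mult_distrib mult.assoc[symmetric] flip: power_add)
      also have "z * cnj z = 1"
        using that by (simp add: complex_norm_square[symmetric])
      finally have e: "cnj (a * z ^ m * cnj (b * z ^ n) / 2) = (b * cnj a / 2) * z ^ (n - m)"
        by (simp add: mult.commute mult.left_commute)
      show ?thesis by (subst e[symmetric]) (simp only: cnj.sel)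
    qed
    then show ?thesis by metis
  qed
  then obtain d k where d: "\<And>z. cmod z = 1 \<Longrightarrow> Re (a * z ^ m * cnj (b * z ^ n) / 2) = Re (d * z ^ k)"
    by blast
  \<comment> \<open>The last summand vanishes on the circle, hence is a monomial with coefficient 0.
    It makes the sum equal to \<open>f z * g z\<close> also where \<open>f\<close> and
    \<open>g\<close> differ from their monomials.\<close>
  have "trig_polynomial (\<lambda>z. Re (a * z ^ m * (b * z ^ n) / 2) + Re (a * z ^ m * cnj (b * z ^ n) / 2) + (f z * g z - Re (a * z ^ m) * Re (b * z ^ n)))"
  proof (intro trig_polynomial.add)
    show "trig_polynomial (\<lambda>z. Re (a * z ^ m * (b * z ^ n) / 2))"
      by (rule monomial[of _ "a * b / 2" "m + n"], rule arg_cong[where f = Re]) (simp add: power_add)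
    show "trig_polynomial (\<lambda>z. Re (a * z ^ m * cnj (b * z ^ n) / 2))"
      by (rule monomial[OF d])
    show "trig_polynomial (\<lambda>z. f z * g z - Re (a * z ^ m) * Re (b * z ^ n))"
      by (rule monomial[of _ 0 0]) (simp add: assms)
  qed
  then show ?thesis unfolding prod[symmetric] by simp
qed

lemma trig_polynomial_mult:
  assumes "trig_polynomial f" "trig_polynomial g"
  shows "trig_polynomial (\<lambda>z. f z * g z)"
  using assms(1)
proof induction
  case (monomial f a m)
  show ?case using assms(2)
  proof induction
    case (monomial g b n)
    then show ?case using trig_polynomial_mult_monomial \<open>\<And>z. cmod z = 1 \<Longrightarrow> f z = Re (a * z ^ m)\<close> by blast
  next
    case (add g1 g2)
    then show ?case by (simp add: distrib_left trig_polynomial.add)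
  qed
next
  case (add f1 f2)
  then show ?case by (simp add: distrib_right trig_polynomial.add)
qed

text \<open>Having an entire function, and not just its harmonic real part, allows
  \<open>exp (- Q z)\<close> to be formed in the comparison argument.\<close>

lemma trig_polynomial_Re_entire:
  assumes "trig_polynomial f"
  shows "\<exists>Q. Q holomorphic_on UNIV \<and> (\<forall>z. cmod z = 1 \<longrightarrow> f z = Re (Q z))"
  using assms
proof induction
  case (monomial f c n)
  then show ?case by (intro exI[of _ "\<lambda>z. c * z ^ n"]) (auto intro!: holomorphic_intros)
next
  case (add f g)
  then obtain Q R where "Q holomorphic_on UNIV" "\<forall>z. cmod z = 1 \<longrightarrow> f z = Re (Q z)"
      "R holomorphic_on UNIV" "\<forall>z. cmod z = 1 \<longrightarrow> g z = Re (R z)" by blast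
  then show ?case by (intro exI[of _ "\<lambda>z. Q z + R z"]) (auto intro!: holomorphic_intros)
qed

text \<open>Stone-Weierstrass: the trigonometric polynomials form an algebra containing the
  constants, and the coordinates \<open>Re\<close> and \<open>Im\<close> separate points.\<close>

lemma circle_approx_Re_entire:
  fixes b :: "complex \<Rightarrow> real"
  assumes "continuous_on (sphere 0 1) b" "e > 0"
  obtains Q where "Q holomorphic_on UNIV" "\<And>z. cmod z = 1 \<Longrightarrow> \<bar>b z - Re (Q z)\<bar> < e"
proof -
  have "\<exists>g. trig_polynomial g \<and> (\<forall>x\<in>sphere 0 1. \<bar>b x - g x\<bar> < e)"
  proof (rule Stone_Weierstrass_HOL[where P = trig_polynomial])
    show "trig_polynomial (\<lambda>x. c)" for c
      by (rule monomial[of _ "of_real c" 0]) auto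
    show "continuous_on (sphere 0 1) f" if "trig_polynomial f" for f
    proof -
      obtain Q where Q: "Q holomorphic_on UNIV" "\<forall>z. cmod z = 1 \<longrightarrow> f z = Re (Q z)"
        using trig_polynomial_Re_entire[OF \<open>trig_polynomial f\<close>] by blast
      have "continuous_on (sphere 0 1) (\<lambda>z. Re (Q z))"
        using Q(1) by (intro continuous_intros continuous_on_subset[OF holomorphic_on_imp_continuous_on]) auto
      then show ?thesis
        by (rule continuous_on_eq) (use Q in auto)
    qed
    show "\<exists>f. trig_polynomial f \<and> f x \<noteq> f y" if "x \<in> sphere 0 1 \<and> y \<in> sphere 0 1 \<and> x \<noteq> y" for x y
    proof (cases "Re x = Re y")
      case True
      then have "Im x \<noteq> Im y" using that by (auto simp: complex_eq_iff)
      moreover have "trig_polynomial Im" by (rule monomial[of _ "-\<i>" 1]) auto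
      ultimately show ?thesis by blast
    next
      case False
      moreover have "trig_polynomial Re" by (rule monomial[of _ 1 1]) auto
      ultimately show ?thesis by blast
    qed
  qed (use assms in \<open>auto intro: trig_polynomial.add trig_polynomial_mult\<close>)
  then show ?thesis
    using trig_polynomial_Re_entire that by (metis mem_sphere_0)
qed

section \<open>Mean value inequalities on circles and disks\<close>

lemma entire_circle_mean:
  assumes "Q holomorphic_on UNIV"
  shows "((\<lambda>t. Q (exp (2 * of_real pi * \<i> * of_real t))) has_integral Q 0) {0..1::real}"
proof -
  have "((\<lambda>u. Q u / (u - 0)) has_contour_integral (2 * of_real pi * \<i>) * Q 0) (circlepath 0 1)"
    by (rule Cauchy_integral_circlepath_simple) (auto intro: holomorphic_on_subset[OF assms])
  then have "((\<lambda>t. (2 * of_real pi * \<i>) * Q (exp (2 * of_real pi * \<i> * of_real t))) has_integral (2 * of_real pi * \<i>) * Q 0) {0..1::real}"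
    unfolding has_contour_integral_def
    by (rule has_integral_eq[rotated]) (auto simp: vector_derivative_circlepath01, simp add: circlepath)
  from has_integral_mult_right[OF this, of "1 / (2 * of_real pi * \<i>)"] show ?thesis
    by simp
qed

text \<open>
  Since \<^term>\<open>1 + cmod w\<close> is the maximum of \<^term>\<open>cmod (1 + c * w)\<close> over unimodular \<open>c\<close>, one would
  like to apply subharmonicity of the logarithm of the modulus. Comparing with the exponential of an
  entire function whose real part approximates the boundary values avoids the zeros of
  \<^term>\<open>1 + c * h z\<close>.
\<close>
lemma ln_one_plus_cmod_circle_mean:
  assumes "continuous_on (cball 0 1) h" "h holomorphic_on ball 0 1"
  shows "ln (1 + cmod (h 0)) \<le> integral {0..1} (\<lambda>t. ln (1 + cmod (h (exp (2 * of_real pi * \<i> * of_real t)))))"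
    (is "_ \<le> integral _ ?b")
proof (rule field_le_epsilon)
  fix e :: real assume e: "e > 0"
  let ?u = "\<lambda>z. ln (1 + cmod (h z))"
  have pos: "1 + cmod x \<noteq> 0" for x by (smt (verit) norm_ge_zero)
  have cu: "continuous_on (sphere 0 1) ?u"
    using assms(1) by (intro continuous_intros pos ballI) (auto elim: continuous_on_subset)
  \<comment> \<open>Approximating \<open>?u z + e / 2\<close> within \<open>e / 2\<close> places
    \<open>Re (Q z)\<close> between \<open>?u z\<close> and \<open>?u z + e\<close> on the circle:
    the lower bound feeds the maximum principle, the upper one the final mean value.\<close>
  obtain Q where Q: "Q holomorphic_on UNIV" "\<And>z. cmod z = 1 \<Longrightarrow> \<bar>?u z + e / 2 - Re (Q z)\<bar> < e / 2"
    by (rule circle_approx_Re_entire[of "\<lambda>z. ?u z + e / 2" "e / 2"]) (use cu e in \<open>auto intro: continuous_on_add\<close>)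
  \<comment> \<open>This rotation turns the triangle inequality
    \<open>cmod (1 + c * h z) \<le> 1 + cmod (h z)\<close> into an equality at 0.\<close>
  obtain c where c: "cmod c = 1" "c * h 0 = of_real (cmod (h 0))"
  proof (cases "h 0 = 0")
    case True then show ?thesis using that[of 1] by simp
  next
    case False
    then show ?thesis using that[of "of_real (cmod (h 0)) / h 0"] by (simp add: norm_divide)
  qed
  let ?H = "\<lambda>z. (1 + c * h z) * exp (- Q z)"
  have "cmod (?H 0) \<le> 1"
  proof (rule maximum_modulus_frontier[of ?H "ball 0 1"])
    show "?H holomorphic_on interior (ball 0 1)"
      using assms(2) Q(1) by (auto intro!: holomorphic_intros elim: holomorphic_on_subset)
    show "continuous_on (closure (ball 0 1)) ?H"
      using assms(1) Q(1) by (auto intro!: continuous_intros elim: continuous_on_subset holomorphic_on_imp_continuous_on[THEN continuous_on_subset])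
    show "cmod (?H z) \<le> 1" if "z \<in> frontier (ball 0 1)" for z
    proof -
      have z: "cmod z = 1" using that by simp
      have "cmod (1 + c * h z) \<le> 1 + cmod (h z)"
        using norm_triangle_ineq[of 1 "c * h z"] c by (simp add: norm_mult)
      also have "\<dots> = exp (?u z)" using pos[of "h z"] by (subst exp_ln) (auto simp: add_pos_nonneg)
      also have "\<dots> \<le> exp (Re (Q z))" using Q(2)[OF z] by (simp only: abs_less_iff exp_le_cancel_iff) linarith
      finally show ?thesis by (simp add: norm_mult norm_divide exp_minus divide_simps)
    qed
  qed auto
  moreover have "cmod (1 + c * h 0) = 1 + cmod (h 0)"
    unfolding c by (metis norm_of_real of_real_1 of_real_add abs_of_nonneg add_nonneg_nonneg norm_ge_zero zero_le_one)
  ultimately have "1 + cmod (h 0) \<le> exp (Re (Q 0))"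
    by (simp add: norm_mult norm_divide exp_minus divide_simps)
  then have "?u 0 \<le> Re (Q 0)"
    by (metis add_pos_nonneg ln_exp ln_le_cancel_iff norm_ge_zero exp_gt_zero zero_less_one)
  also have "\<dots> \<le> integral {0..1} (\<lambda>t. ?b t + e)"
  proof (rule has_integral_le)
    let ?E = "\<lambda>t. exp (2 * of_real pi * \<i> * of_real t)"
    show "((\<lambda>t. Re (Q (?E t))) has_integral Re (Q 0)) {0..1::real}"
      using has_integral_linear[OF entire_circle_mean[OF Q(1)] bounded_linear_Re] by (simp add: o_def)
    have "continuous_on {0..1} (\<lambda>t. ?u (?E t) + e)"
      by (intro continuous_intros continuous_on_compose2[OF cu]) (auto)
    then show "((\<lambda>t. ?b t + e) has_integral integral {0..1} (\<lambda>t. ?b t + e)) {0..1}"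
      by (intro integrable_integral integrable_continuous_real)
    show "Re (Q (?E t)) \<le> ?b t + e" if "t \<in> {0..1}" for t
    proof -
      have "cmod (?E t) = 1" by simp
      from Q(2)[OF this] show ?thesis by (simp only: abs_less_iff) linarith
    qed
  qed
  also have "\<dots> = integral {0..1} ?b + e"
  proof (subst integral_add)
    show "?b integrable_on {0..1}"
      by (intro integrable_continuous_real continuous_on_compose2[OF cu] continuous_intros) auto
  qed auto
  finally show "?u 0 \<le> integral {0..1} ?b + e" .
qed

text \<open>Convexity puts the graph above its tangent at \<open>a\<close>. The point
  \<open>x = 0\<close> is separate because convexity is taken on the open half-line; there the left
  side is \<open>(1 - p) * a powr p\<close>, at most 0.\<close>

lemma powr_above_tangent:
  fixes a p x :: real
  assumes "1 \<le> p" "0 < a" "0 \<le> x"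
  shows "a powr p + p * a powr (p - 1) * (x - a) \<le> x powr p"
proof (cases "x = 0")
  case True
  have "a powr (p - 1) * a = a powr p"
    using assms by (simp add: powr_diff)
  then have "a powr p + p * a powr (p - 1) * (x - a) = (1 - p) * a powr p"
    using True by (simp add: algebra_simps)
  then show ?thesis using assms True by (simp add: mult_nonpos_nonneg)
next
  case False
  have "x powr p - a powr p \<ge> p * a powr (p - 1) * (x - a)"
  proof (rule convex_on_imp_above_tangent[where A = "{0<..}"])
    show "convex_on {0<..} (\<lambda>x. x powr p)" using assms by (intro powr_convex)
    show "((\<lambda>x. x powr p) has_real_derivative p * a powr (p - 1)) (at a within {0<..})"
      using assms by (intro has_field_derivative_at_within[OF has_real_derivative_powr])
  qed (use assms False in \<open>auto simp: interior_open\<close>)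
  then show ?thesis by simp
qed

text \<open>Jensen's inequality in tangent form: the tangent to the power function at
  \<open>a = ln (1 + cmod (h 0))\<close> is integrated over the circle, and its linear term has
  nonnegative mean by \<open>ln_one_plus_cmod_circle_mean\<close>.\<close>

lemma ln_one_plus_cmod_powr_circle_mean:
  assumes "1 \<le> p" and h: "continuous_on (cball 0 1) h" "h holomorphic_on ball 0 1"
  shows "ennreal (ln (1 + cmod (h 0)) powr p) \<le>
    (\<integral>\<^sup>+t. ennreal (ln (1 + cmod (h (exp (2 * of_real pi * \<i> * of_real t)))) powr p) * indicator {0..1::real} t \<partial>lborel)"
proof (cases "h 0 = 0")
  case False
  let ?u = "\<lambda>z. ln (1 + cmod (h z))" and ?E = "\<lambda>t::real. exp (2 * of_real pi * \<i> * of_real t)"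
  define a where "a = ?u 0"
  have pos: "1 + cmod x \<noteq> 0" for x by (smt (verit) norm_ge_zero)
  have a: "a > 0" using False by (simp add: a_def ln_gt_zero)
  have cu: "continuous_on {0..1} (\<lambda>t. ?u (?E t))"
    by (intro continuous_intros continuous_on_compose2[OF h(1)] ballI pos) auto
  have cp: "continuous_on {0..1} (\<lambda>t. ?u (?E t) powr p)"
    using assms(1) cu by (intro continuous_on_powr') (auto intro!: continuous_intros)
  let ?I = "integral {0..1} (\<lambda>t. ?u (?E t))"
  have I: "((\<lambda>t. ?u (?E t)) has_integral ?I) {0..1}"
    by (intro integrable_integral integrable_continuous_real cu)
  have c: "((\<lambda>t. k) has_integral k) {0..1::real}" for k :: real
    using has_integral_const_real[of k 0 1] by simp
  have "((\<lambda>t. a powr p + p * a powr (p - 1) * (?u (?E t) - a)) has_integral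
      (a powr p + p * a powr (p - 1) * (?I - a))) {0..1}"
    by (rule has_integral_add[OF c has_integral_mult_right[OF has_integral_diff[OF I c]]])
  then have "a powr p + p * a powr (p - 1) * (?I - a) \<le> integral {0..1} (\<lambda>t. ?u (?E t) powr p)"
    using powr_above_tangent[OF assms(1) a]
    by (intro has_integral_le[OF _ integrable_integral[OF integrable_continuous_real[OF cp]]]) auto
  moreover have "0 \<le> p * a powr (p - 1) * (?I - a)"
    using ln_one_plus_cmod_circle_mean[OF h] assms(1) by (simp add: a_def)
  ultimately have "a powr p \<le> integral {0..1} (\<lambda>t. ?u (?E t) powr p)"
    by linarith
  then have "ennreal (a powr p) \<le> ennreal (integral {0..1} (\<lambda>t. ?u (?E t) powr p))"
    by (rule ennreal_leI)
  also have "ennreal (integral {0..1} (\<lambda>t. ?u (?E t) powr p)) =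
      (\<integral>\<^sup>+t. ennreal (?u (?E t) powr p) * indicator {0..1::real} t \<partial>lborel)"
    by (intro nn_integral_has_integral_lebesgue'[symmetric] integrable_integral integrable_continuous_real cp) auto
  finally show ?thesis unfolding a_def .
qed simp

text \<open>For fixed \<open>w\<close> the circle inequality is applied to
  \<open>\<zeta> \<mapsto> h (z + \<zeta> * w)\<close>. After integration over \<open>w\<close> and
  exchange of the order, rotation invariance makes the inner integral the same for every angle; this
  takes the place of polar coordinates.\<close>

lemma ln_one_plus_cmod_powr_area_mean:
  assumes p: "1 \<le> p" and h: "h holomorphic_on S" "cball z r \<subseteq> S" and r: "r > 0"
  shows "ennreal (pi * r\<^sup>2) * ennreal (ln (1 + cmod (h z)) powr p) \<le>
    (\<integral>\<^sup>+w. ennreal (ln (1 + cmod (h w)) powr p) * indicator (ball z r) w \<partial>lborel)"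
proof -
  define G where "G = (\<lambda>w. ennreal (ln (1 + cmod (h w)) powr p) * indicator (ball z r) w)"
  let ?E = "\<lambda>t::real. exp (2 * of_real pi * \<i> * of_real t)"
  have [measurable]: "G \<in> borel_measurable borel"
    unfolding G_def using p h ball_subset_cball[of z r]
    by (intro borel_measurable_ennreal_indicator_ball continuous_on_ln_one_plus_powr continuous_intros
        continuous_on_subset[OF holomorphic_on_imp_continuous_on[OF h(1)]]) auto
  have mean: "ennreal (ln (1 + cmod (h z)) powr p) * indicator (ball 0 r) w
      \<le> (\<integral>\<^sup>+t. G (z + ?E t * w) * indicator {0..1} t \<partial>lborel)" for w
  proof (cases "w \<in> ball 0 r")
    case True
    have sub: "z + \<zeta> * w \<in> S" if "\<zeta> \<in> cball 0 1" for \<zeta>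
    proof -
      have "cmod \<zeta> * cmod w \<le> 1 * r" using that True by (intro mult_mono) auto
      then have "z + \<zeta> * w \<in> cball z r" by (simp add: dist_norm norm_mult)
      then show ?thesis using h by blast
    qed
    have "ennreal (ln (1 + cmod (h (z + 0 * w))) powr p) \<le>
      (\<integral>\<^sup>+t. ennreal (ln (1 + cmod (h (z + ?E t * w))) powr p) * indicator {0..1::real} t \<partial>lborel)"
    proof (rule ln_one_plus_cmod_powr_circle_mean[OF p])
      show "continuous_on (cball 0 1) (\<lambda>\<zeta>. h (z + \<zeta> * w))"
        using sub by (intro continuous_on_compose2[OF holomorphic_on_imp_continuous_on[OF h(1)]] continuous_intros) auto
      show "(\<lambda>\<zeta>. h (z + \<zeta> * w)) holomorphic_on ball 0 1"
        using sub by (intro holomorphic_on_compose_gen[OF _ h(1), unfolded o_def] holomorphic_intros) auto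
    qed
    also have "\<dots> = (\<integral>\<^sup>+t. G (z + ?E t * w) * indicator {0..1} t \<partial>lborel)"
      using True by (intro nn_integral_cong) (auto simp: G_def dist_norm norm_mult)
    finally show ?thesis using True by simp
  qed simp
  have "ennreal (pi * r\<^sup>2) * ennreal (ln (1 + cmod (h z)) powr p) =
     (\<integral>\<^sup>+w. ennreal (ln (1 + cmod (h z)) powr p) * indicator (ball 0 r) (w::complex) \<partial>lborel)"
    using r by (subst nn_integral_cmult_indicator) (simp_all add: emeasure_ball unit_ball_vol_2 mult.commute)
  also have "\<dots> \<le> (\<integral>\<^sup>+w. \<integral>\<^sup>+t. G (z + ?E t * w) * indicator {0..1} t \<partial>lborel \<partial>lborel)"
    by (intro nn_integral_mono mean)
  also have "\<dots> = (\<integral>\<^sup>+t. \<integral>\<^sup>+w. G (z + ?E t * w) * indicator {0..1} t \<partial>lborel \<partial>lborel)"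
    by (intro lborel_pair.Fubini') measurable
  also have "\<dots> = (\<integral>\<^sup>+t. (\<integral>\<^sup>+w. G w \<partial>lborel) * indicator {0..1} t \<partial>(lborel :: real measure))"
  proof (rule nn_integral_cong)
    fix t :: real
    have "(\<integral>\<^sup>+w. G (z + ?E t * w) * indicator {0..1} t \<partial>lborel)
        = (\<integral>\<^sup>+w. G (z + ?E t * w) \<partial>lborel) * indicator {0..1} t"
      by (intro nn_integral_multc) measurable
    also have "(\<integral>\<^sup>+w. G (z + ?E t * w) \<partial>lborel) = (\<integral>\<^sup>+w. G (z + w) \<partial>lborel)"
      by (intro nn_integral_lborel_rotate) auto
    also have "\<dots> = (\<integral>\<^sup>+w. G w \<partial>lborel)"
      by (intro nn_integral_lborel_translate) auto
    finally show "(\<integral>\<^sup>+w. G (z + ?E t * w) * indicator {0..1} t \<partial>lborel)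
        = (\<integral>\<^sup>+w. G w \<partial>lborel) * indicator {0..1} t" .
  qed
  also have "\<dots> = (\<integral>\<^sup>+w. G w \<partial>lborel)"
    by (simp add: nn_integral_cmult_indicator)
  finally show ?thesis unfolding G_def .
qed

section \<open>Averaging at the scales of the Whitney disks\<close>

text \<open>
  The dilates of the set by the powers of \<open>1 - \<delta>\<close> lie in disjoint annuli. About \<open>\<rho> / \<delta>\<close> of them
  have comparable area and stay inside a disk of radius \<open>2 \<rho>\<close>, which replaces polar coordinates.
\<close>
lemma emeasure_boundary_strip_le:
  fixes w :: complex
  assumes \<rho>: "0 < \<rho>" "\<rho> \<le> R" and \<delta>: "0 < \<delta>" and R: "1 \<le> R"
  shows "emeasure lborel {z. cmod (z - w) < \<rho> \<and> cmod z < 1 \<and> 1 - \<delta> \<le> cmod z} \<le> ennreal (64 * pi * R * \<rho> * \<delta>)"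
proof -
  let ?E = "{z. cmod (z - w) < \<rho> \<and> cmod z < 1 \<and> 1 - \<delta> \<le> cmod z}"
  have meas[measurable]: "?E \<in> sets borel" by measurable
  have sub: "?E \<subseteq> ball w \<rho>" by (auto simp: dist_norm norm_minus_commute)
  have lm: "?E \<in> lmeasurable"
    by (rule bounded_set_imp_lmeasurable) (use sub meas bounded_subset in \<open>auto intro: bounded_subset[OF bounded_ball]\<close>)
  have area: "measure lebesgue (ball c r) = pi * r\<^sup>2" if "r \<ge> 0" for c :: complex and r
    using that by (simp add: content_ball unit_ball_vol_2)
  have "measure lebesgue ?E \<le> 64 * pi * R * \<rho> * \<delta>"
  \<comment> \<open>If the strip is not thin compared with \<open>\<rho>\<close>, the area of the
    whole disk is already within the bound; the dilates serve the thin case.\<close>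
  proof (cases "4 * R * \<delta> \<le> \<rho>")
    case False
    have "measure lebesgue ?E \<le> measure lebesgue (ball w \<rho>)"
      using sub lm by (intro measure_mono_fmeasurable) auto
    also have "\<dots> = pi * \<rho> * \<rho>" using \<rho> by (subst area) (simp_all add: power2_eq_square)
    also have "\<dots> \<le> pi * \<rho> * (64 * R * \<delta>)"
      using False \<rho> \<delta> R by (intro mult_left_mono) auto
    finally show ?thesis by (simp add: mult_ac)
  next
    case True
    \<comment> \<open>This choice makes \<open>real M * \<delta>\<close> at most
      \<open>\<rho> / (4 * R)\<close>, hence at most \<open>1 / 4\<close> and at most
      \<open>\<rho>\<close>. The first keeps \<open>t ^ m\<close> above \<open>3 / 4\<close>, so
      that each dilate retains half of the area; the second limits the displacement to
      \<open>\<rho>\<close>.\<close>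
    define M where "M = nat \<lfloor>\<rho> / (4 * R * \<delta>)\<rfloor>"
    define t where "t = 1 - \<delta>"
    have M: "real M \<le> \<rho> / (4 * R * \<delta>)" "\<rho> / (4 * R * \<delta>) < real M + 1" "1 \<le> real M"
      using True \<rho> \<delta> R unfolding M_def by (auto simp: le_nat_iff le_floor_iff)
    have M': "real M * \<delta> \<le> \<rho> / (4 * R)"
      using M(1) \<delta> R by (simp add: field_simps)
    have le4: "\<rho> / (4 * R) \<le> 1 / 4" "\<rho> / (4 * R) \<le> \<rho>"
      using \<rho> R by (auto simp: field_simps)
    have "\<delta> \<le> real M * \<delta>" using M \<delta> by simp
    then have t: "0 < t" "t < 1" using M' le4(1) \<delta> unfolding t_def by linarith+
    have tm: "1 - real m * \<delta> \<le> t ^ m" "1 - real m * \<delta> \<ge> 3 / 4" "real m * \<delta> \<le> \<rho>" if "m < M" for m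
    proof -
      show "1 - real m * \<delta> \<le> t ^ m"
        using Bernoulli_inequality[of "-\<delta>" m] t by (simp add: t_def)
      have "real m * \<delta> \<le> real M * \<delta>" using that \<delta> by simp
      then show "1 - real m * \<delta> \<ge> 3 / 4" "real m * \<delta> \<le> \<rho>" using M' le4 by auto
    qed
    \<comment> \<open>The summand 0 gives the map the affine shape of
      \<open>measure_lebesgue_affine\<close>.\<close>
    define A where "A m = (\<lambda>z. (t ^ m) *\<^sub>R z + 0) ` ?E" for m
    have Am: "measure lebesgue (A m) = (t ^ m)\<^sup>2 * measure lebesgue ?E" for m
      unfolding A_def using t by (subst measure_lebesgue_affine) auto
    have Alm: "A m \<in> lmeasurable" for m
    proof (rule fmeasurableI)
      have "A m = {x. cmod (x /\<^sub>R t ^ m - w) < \<rho> \<and> cmod (x /\<^sub>R t ^ m) < 1 \<and> 1 - \<delta> \<le> cmod (x /\<^sub>R t ^ m)}"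
        using t unfolding A_def by (auto intro!: image_eqI[of _ _ "_ /\<^sub>R t ^ m"] simp: mult.assoc[symmetric])
      also have "\<dots> \<in> sets borel" by measurable
      finally show "A m \<in> sets lebesgue" by simp
      show "emeasure lebesgue (A m) < \<infinity>"
        unfolding A_def using lm by (subst emeasure_lebesgue_affine) (auto simp: fmeasurable_def ennreal_mult_less_top)
    qed
    \<comment> \<open>\<open>A m\<close> lies in the annulus of radii from \<open>t ^ Suc m\<close>
      to \<open>t ^ m\<close>, outer radius excluded.\<close>
    have disj: "disjoint_family_on A {..<M}"
      unfolding disjoint_family_on_def
    proof (intro ballI impI, rule ccontr)
      fix m n assume mn: "m \<noteq> n" "A m \<inter> A n \<noteq> {}"
      have less: False if "m < n" "x \<in> A m" "x \<in> A n" for m n x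
      proof -
        from that(2) obtain y where y: "x = t ^ m *\<^sub>R y" "t \<le> cmod y"
          by (auto simp: A_def t_def)
        from that(3) obtain z where z: "x = t ^ n *\<^sub>R z" "cmod z < 1"
          by (auto simp: A_def)
        have "cmod x < t ^ n" using z t by simp
        also have "\<dots> \<le> t ^ Suc m" using that t by (intro power_decreasing) auto
        also have "\<dots> \<le> t ^ m * cmod y" using y t by simp
        also have "\<dots> = cmod x" using y t by simp
        finally show False by simp
      qed
      from mn obtain x where "x \<in> A m" "x \<in> A n" by auto
      with less[of m n x] less[of n m x] mn(1) show False by linarith
    qed
    have "real M * (measure lebesgue ?E / 2) \<le> (\<Sum>m<M. measure lebesgue (A m))"
    proof -
      have "measure lebesgue ?E / 2 \<le> measure lebesgue (A m)" if "m < M" for m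
      proof -
        have "(3 / 4)\<^sup>2 \<le> (t ^ m)\<^sup>2" using tm[OF that] by (intro power_mono) auto
        then have "1 / 2 \<le> (t ^ m)\<^sup>2" by (simp add: power2_eq_square)
        then have "1 / 2 * measure lebesgue ?E \<le> (t ^ m)\<^sup>2 * measure lebesgue ?E"
          by (intro mult_right_mono) auto
        then show ?thesis by (simp add: Am)
      qed
      then have "(\<Sum>m<M. measure lebesgue ?E / 2) \<le> (\<Sum>m<M. measure lebesgue (A m))"
        by (intro sum_mono) auto
      then show ?thesis by simp
    qed
    also have "\<dots> = measure lebesgue (\<Union>m<M. A m)"
    proof (rule measure_finite_Union[symmetric])
      show "A ` {..<M} \<subseteq> sets lebesgue" using fmeasurableD[OF Alm] by blast
      show "emeasure lebesgue (A m) \<noteq> \<infinity>" for m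
        unfolding infinity_ennreal_def by (rule fmeasurableD2[OF Alm])
    qed (use disj in auto)
    also have "\<dots> \<le> measure lebesgue (ball w (2 * \<rho>))"
    proof (rule measure_mono_fmeasurable)
      show "(\<Union>m<M. A m) \<subseteq> ball w (2 * \<rho>)"
      proof clarify
        fix m x assume m: "m < M" "x \<in> A m"
        then obtain z where z: "x = t ^ m *\<^sub>R z" "cmod (z - w) < \<rho>" "cmod z < 1"
          by (auto simp: A_def)
        have "x - z = (t ^ m - 1) *\<^sub>R z" by (simp add: z algebra_simps)
        then have "cmod (x - z) = (1 - t ^ m) * cmod z"
          using t by (simp add: power_le_one)
        also have "\<dots> \<le> (1 - t ^ m) * 1"
          using t z by (intro mult_left_mono) (auto simp: power_le_one)
        also have "\<dots> \<le> \<rho>" using tm[OF m(1)] by simp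
        finally have "cmod (x - w) < 2 * \<rho>"
          using norm_triangle_ineq[of "x - z" "z - w"] z by simp
        then show "x \<in> ball w (2 * \<rho>)" by (simp add: dist_norm norm_minus_commute)
      qed
    qed (use fmeasurableD[OF Alm] in \<open>auto intro!: sets.finite_UN\<close>)
    also have "\<dots> = 4 * pi * \<rho>\<^sup>2" using \<rho> by (subst area) (simp_all add: power_mult_distrib)
    finally have "real M * measure lebesgue ?E \<le> 8 * pi * \<rho>\<^sup>2" by simp
    \<comment> \<open>Rounding down loses at most a factor 2, because \<open>1 \<le> real M\<close>
      gives \<open>real M + 1 \<le> 2 * real M\<close>.\<close>
    moreover have "\<rho> / (8 * R * \<delta>) \<le> real M"
    proof -
      have "\<rho> / (8 * R * \<delta>) = \<rho> / (4 * R * \<delta>) / 2" by simp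
      then show ?thesis using M(2,3) by linarith
    qed
    then have "\<rho> / (8 * R * \<delta>) * measure lebesgue ?E \<le> real M * measure lebesgue ?E"
      by (intro mult_right_mono) auto
    ultimately have "\<rho> / (8 * R * \<delta>) * measure lebesgue ?E \<le> 8 * pi * \<rho>\<^sup>2"
      by linarith
    then have "\<rho> * measure lebesgue ?E \<le> \<rho> * (64 * pi * R * \<rho> * \<delta>)"
      using \<rho> \<delta> R by (simp add: field_simps power2_eq_square del: mult_le_cancel_left_pos)
    then show ?thesis using \<rho> by simp
  qed
  then have "ennreal (measure lebesgue ?E) \<le> ennreal (64 * pi * R * \<rho> * \<delta>)"
    by (rule ennreal_leI)
  also have "ennreal (measure lebesgue ?E) = emeasure lborel ?E"
  proof -
    have "emeasure lborel ?E \<le> emeasure lborel (ball w \<rho>)" using sub by (intro emeasure_mono) auto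
    then have "emeasure lborel ?E \<noteq> top"
      using emeasure_lborel_ball_finite[of w \<rho>] by (auto simp: top_unique)
    then show ?thesis by (simp add: emeasure_eq_ennreal_measure)
  qed
  finally show ?thesis .
qed

section \<open>The averaging kernels and their weighted bounds\<close>

text \<open>For \<open>-1 < \<alpha>\<close> this is the density of \<open>weighted_area\<close> up
  to factors bounded above and below. Written in \<open>1 - cmod z\<close>, it scales directly with
  the radii in \<open>hardy_kernel\<close>.\<close>

definition disk_weight :: "real \<Rightarrow> complex \<Rightarrow> ennreal" where
  "disk_weight \<alpha> z = ennreal ((1 - cmod z) powr \<alpha>) * indicator (ball 0 1) z"

text \<open>
  Up to a constant, \<open>hardy_kernel j z\<close> averages over a Whitney disk of radius about
  \<open>2\<^sup>j (1 - |z|)\<close> that lies at distance of the same order from \<open>z\<close> and from the unit circle.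
\<close>
definition hardy_kernel :: "nat \<Rightarrow> complex \<Rightarrow> complex \<Rightarrow> ennreal" where
  "hardy_kernel j z w =
     (if cmod z < 1 \<and> cmod w < 1 \<and> 2 ^ j * (1 - cmod z) \<le> 4 * (1 - cmod w)
         \<and> cmod (w - z) < 3 * (2 ^ j * (1 - cmod z))
      then ennreal (1 / (2 ^ j * (1 - cmod z))\<^sup>2) else 0)"

lemma disk_weight_measurable [measurable]: "disk_weight \<alpha> \<in> borel_measurable borel"
proof -
  have "disk_weight \<alpha> = (\<lambda>z. if cmod z < 1 then ennreal ((1 - cmod z) powr \<alpha>) else 0)"
    by (auto simp: disk_weight_def indicator_def)
  then show ?thesis by simp
qed

lemma hardy_kernel_measurable [measurable]:
  assumes [measurable]: "f \<in> borel_measurable M" "g \<in> borel_measurable M"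
  shows "(\<lambda>x. hardy_kernel j (f x) (g x)) \<in> borel_measurable M"
  unfolding hardy_kernel_def by measurable

text \<open>Put \<open>e = 1 - cmod w\<close>. On the support of the kernel
  \<open>2 ^ j * (1 - cmod z)\<close> is comparable to \<open>e\<close>, so the kernel is of order
  \<open>1 / e\<^sup>2\<close> and the weight of order
  \<open>(2 powr - \<alpha>) ^ j * e powr \<alpha>\<close>, while \<open>z\<close> ranges over a
  strip of area at most of order \<open>e\<^sup>2 / 2 ^ j\<close>.\<close>

lemma disk_weight_hardy_kernel_le:
  fixes \<alpha> :: real
  defines "K \<equiv> 64 * 64 * 144 * pi * 4 powr \<bar>\<alpha>\<bar>"
  shows "(\<integral>\<^sup>+z. disk_weight \<alpha> z * hardy_kernel j z w \<partial>lborel) \<le> ennreal (K * (2 powr - (\<alpha> + 1)) ^ j) * disk_weight \<alpha> w"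
proof (cases "cmod w < 1")
  case False
  then show ?thesis by (simp add: hardy_kernel_def)
next
  case True
  define e where "e = 1 - cmod w"
  have e: "0 < e" "e \<le> 1" using True by (auto simp: e_def)
  define \<delta> where "\<delta> = 4 * e / 2 ^ j"
  have \<delta>: "0 < \<delta>" using e by (simp add: \<delta>_def)
  let ?E = "{z. cmod (z - w) < 12 * e \<and> cmod z < 1 \<and> 1 - \<delta> \<le> cmod z}"
  define c where "c = (2 powr - \<alpha>) ^ j * 4 powr \<bar>\<alpha>\<bar> * e powr \<alpha> * (16 / e\<^sup>2)"
  have c: "0 \<le> c" using e by (simp add: c_def)
  have "disk_weight \<alpha> z * hardy_kernel j z w \<le> ennreal c * indicator ?E z" for z
  proof (cases "hardy_kernel j z w = 0")
    case False
    define D where "D = 2 ^ j * (1 - cmod z)"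
    from False have z: "cmod z < 1" "D \<le> 4 * e" "cmod (w - z) < 3 * D"
      by (auto simp: hardy_kernel_def D_def e_def split: if_splits)
    have D: "0 < D" using z by (simp add: D_def)
    have d: "1 - cmod z = D / 2 ^ j" by (simp add: D_def)
    have "1 - cmod z \<le> D"
      using mult_right_mono[of 1 "2 ^ j" "1 - cmod z"] z by (simp add: D_def)
    \<comment> \<open>This combines \<open>1 - cmod w \<le> (1 - cmod z) + cmod (w - z)\<close> with
      the bounds \<open>D\<close> and \<open>3 * D\<close> for the two summands.\<close>
    then have eD: "e \<le> 4 * D"
      using z(3) norm_triangle_ineq2[of z w] norm_minus_commute[of z w] unfolding e_def
      by (smt (verit) norm_triangle_ineq2)
    \<comment> \<open>Bounding the logarithm of the ratio in absolute value handles both signs of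
      \<open>\<alpha>\<close> at once.\<close>
    have "\<bar>ln (D / e)\<bar> \<le> ln 4"
    proof -
      have "ln (D / e) \<le> ln 4" using D e z by (intro ln_mono) (auto simp: field_simps)
      moreover have "ln (e / D) \<le> ln 4" using D e eD by (intro ln_mono) (auto simp: field_simps)
      moreover have "ln (e / D) = - ln (D / e)" using D e by (simp add: ln_div)
      ultimately show ?thesis by linarith
    qed
    then have "\<bar>\<alpha>\<bar> * \<bar>ln (D / e)\<bar> \<le> \<bar>\<alpha>\<bar> * ln 4" by (intro mult_left_mono) auto
    then have "\<alpha> * ln (D / e) \<le> \<bar>\<alpha>\<bar> * ln 4"
      by (metis abs_mult abs_ge_self order_trans)
    then have "(D / e) powr \<alpha> \<le> 4 powr \<bar>\<alpha>\<bar>" using D e by (simp add: powr_def)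
    then have "D powr \<alpha> \<le> 4 powr \<bar>\<alpha>\<bar> * e powr \<alpha>"
      using D e by (simp add: powr_divide field_simps)
    moreover have "(1 - cmod z) powr \<alpha> = (2 powr - \<alpha>) ^ j * D powr \<alpha>"
    proof -
      have "(2 ^ j) powr \<alpha> = (2 powr \<alpha>) ^ j"
        by (simp add: powr_power powr_realpow[symmetric] powr_powr mult.commute)
      then show ?thesis
        using D unfolding d by (simp add: powr_divide powr_minus power_inverse field_simps)
    qed
    ultimately have "(1 - cmod z) powr \<alpha> \<le> (2 powr - \<alpha>) ^ j * (4 powr \<bar>\<alpha>\<bar> * e powr \<alpha>)"
      by (simp add: mult_left_mono)
    moreover have "1 / D\<^sup>2 \<le> 16 / e\<^sup>2"
      using power_mono[OF eD, of 2] D e by (simp add: field_simps)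
    ultimately have "(1 - cmod z) powr \<alpha> * (1 / D\<^sup>2) \<le> c"
      unfolding c_def using D by (metis (no_types, lifting) mult.assoc mult_mono powr_ge_zero mult_nonneg_nonneg zero_le_divide_1_iff zero_le_power2 zero_le_power)
    moreover have "z \<in> ?E"
      using z d D by (auto simp: norm_minus_commute \<delta>_def field_simps)
    moreover have "hardy_kernel j z w = ennreal (1 / D\<^sup>2)"
      using False by (auto simp: hardy_kernel_def D_def)
    ultimately show ?thesis
      using z D by (simp add: disk_weight_def ennreal_mult'[symmetric] ennreal_leI)
  qed simp
  then have "(\<integral>\<^sup>+z. disk_weight \<alpha> z * hardy_kernel j z w \<partial>lborel) \<le> (\<integral>\<^sup>+z. ennreal c * indicator ?E z \<partial>lborel)"
    by (intro nn_integral_mono) auto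
  also have "\<dots> = ennreal c * emeasure lborel ?E"
    by (intro nn_integral_cmult_indicator) measurable
  also have "\<dots> \<le> ennreal c * ennreal (64 * pi * 12 * (12 * e) * \<delta>)"
    using e \<delta> by (intro mult_left_mono emeasure_boundary_strip_le) auto
  also have "\<dots> = ennreal (c * (64 * pi * 12 * (12 * e) * \<delta>))"
    using c e \<delta> by (simp add: ennreal_mult)
  also have "c * (64 * pi * 12 * (12 * e) * \<delta>) = K * (2 powr - (\<alpha> + 1)) ^ j * e powr \<alpha>"
  proof -
    have "(2 powr - (\<alpha> + 1)) ^ j = (2 powr - \<alpha>) ^ j / 2 ^ j"
      by (simp add: powr_diff power_divide)
    then show ?thesis
      using e by (simp add: K_def c_def \<delta>_def field_simps power2_eq_square)
  qed
  also have "ennreal \<dots> = ennreal (K * (2 powr - (\<alpha> + 1)) ^ j) * disk_weight \<alpha> w"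
    using True by (simp add: disk_weight_def ennreal_mult' e_def K_def)
  finally show ?thesis .
qed

text \<open>Tonelli turns the bound for the kernel integrated in \<open>z\<close> into boundedness
  of the averaging operator on the weighted space of integrable functions.\<close>

lemma nn_integral_disk_weight_hardy_kernel_le:
  fixes \<alpha> :: real
  defines "K \<equiv> 64 * 64 * 144 * pi * 4 powr \<bar>\<alpha>\<bar>"
  assumes [measurable]: "F \<in> borel_measurable borel"
  shows "(\<integral>\<^sup>+z. disk_weight \<alpha> z * (\<integral>\<^sup>+w. hardy_kernel j z w * F w \<partial>lborel) \<partial>lborel)
    \<le> ennreal (K * (2 powr - (\<alpha> + 1)) ^ j) * (\<integral>\<^sup>+w. disk_weight \<alpha> w * F w \<partial>lborel)"
proof -
  have "(\<integral>\<^sup>+z. disk_weight \<alpha> z * (\<integral>\<^sup>+w. hardy_kernel j z w * F w \<partial>lborel) \<partial>lborel)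
      = (\<integral>\<^sup>+z. \<integral>\<^sup>+w. disk_weight \<alpha> z * hardy_kernel j z w * F w \<partial>lborel \<partial>lborel)"
    by (simp add: nn_integral_cmult mult.assoc)
  also have "\<dots> = (\<integral>\<^sup>+w. \<integral>\<^sup>+z. disk_weight \<alpha> z * hardy_kernel j z w * F w \<partial>lborel \<partial>lborel)"
    by (intro lborel_pair.Fubini') measurable
  also have "\<dots> = (\<integral>\<^sup>+w. (\<integral>\<^sup>+z. disk_weight \<alpha> z * hardy_kernel j z w \<partial>lborel) * F w \<partial>lborel)"
    by (simp add: nn_integral_multc)
  also have "\<dots> \<le> (\<integral>\<^sup>+w. ennreal (K * (2 powr - (\<alpha> + 1)) ^ j) * disk_weight \<alpha> w * F w \<partial>lborel)"
    unfolding K_def by (intro nn_integral_mono mult_right_mono disk_weight_hardy_kernel_le) auto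
  also have "\<dots> = ennreal (K * (2 powr - (\<alpha> + 1)) ^ j) * (\<integral>\<^sup>+w. disk_weight \<alpha> w * F w \<partial>lborel)"
    by (simp add: nn_integral_cmult mult.assoc)
  finally show ?thesis .
qed

section \<open>Elementary inequalities for logarithms and powers of sums\<close>

text \<open>Bernoulli's inequality \<open>1 + c * s \<le> (1 + s) powr c\<close>, the tangent at 1,
  moves constants out of the logarithm.\<close>

lemma ln_one_plus_mult_le:
  fixes s c :: real
  assumes "0 \<le> s" "1 \<le> c"
  shows "ln (1 + c * s) \<le> c * ln (1 + s)"
proof -
  have "1 + c * s \<le> (1 + s) powr c"
  proof -
    have "1 powr c + c * 1 powr (c - 1) * ((1 + s) - 1) \<le> (1 + s) powr c"
      using assms by (intro powr_above_tangent) auto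
    then show ?thesis by simp
  qed
  then have "ln (1 + c * s) \<le> ln ((1 + s) powr c)"
    using assms by (intro ln_mono) (auto simp: add_pos_nonneg)
  also have "\<dots> = c * ln (1 + s)" using assms by (simp add: ln_powr)
  finally show ?thesis .
qed

lemma ln_one_plus_cmod_sum_le:
  fixes x :: "nat \<Rightarrow> complex"
  shows "ln (1 + cmod (\<Sum>j<N. x j)) \<le> (\<Sum>j<N. ln (1 + cmod (x j)))"
proof (induction N)
  case (Suc N)
  let ?a = "cmod (\<Sum>j<N. x j)" and ?b = "cmod (x N)"
  have "ln (1 + cmod (\<Sum>j<Suc N. x j)) \<le> ln ((1 + ?a) * (1 + ?b))"
  proof (intro ln_mono)
    have "cmod (\<Sum>j<Suc N. x j) \<le> ?a + ?b" by (simp add: norm_triangle_ineq)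
    then show "1 + cmod (\<Sum>j<Suc N. x j) \<le> (1 + ?a) * (1 + ?b)"
      using mult_nonneg_nonneg[of ?a ?b, OF norm_ge_zero norm_ge_zero]
      by (simp only: ring_distribs)
  qed (auto simp: add_pos_nonneg)
  also have "\<dots> = ln (1 + ?a) + ln (1 + ?b)"
    by (intro ln_mult_pos) (auto simp: add_pos_nonneg)
  finally show ?case using Suc by simp
qed simp

text \<open>
  A weighted Jensen inequality: the loss is only a factor \<open>l powr (1 - p)\<close> per step, which for \<open>l\<close>
  close to 1 is beaten by the decay in \<open>disk_weight_hardy_kernel_le\<close>. This is Hardy's inequality.
\<close>
lemma powr_sum_le_geometric:
  fixes p l :: real and a :: "nat \<Rightarrow> real"
  assumes p: "1 \<le> p" and l: "0 < l" "l < 1" and a: "\<And>j. 0 \<le> a j"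
  shows "(\<Sum>j<N. a j) powr p \<le> (1 - l) powr (1 - p) * (\<Sum>j<N. (l powr (1 - p)) ^ j * a j powr p)"
  using a
proof (induction N arbitrary: a)
  case (Suc N)
  let ?b = "\<Sum>j<N. a (Suc j)"
  have b: "0 \<le> ?b" using Suc.prems by (simp add: sum_nonneg)
  have two: "(x + y) powr p \<le> (1 - l) powr (1 - p) * x powr p + l powr (1 - p) * y powr p"
    if "0 \<le> x" "0 \<le> y" for x y
  proof (cases "x + y = 0")
    case True
    then have "x = 0" "y = 0" using that by auto
    then show ?thesis by simp
  next
    case False
    define m where "m = x + y"
    have m: "0 < m" using False that by (simp add: m_def)
    have s: "k powr (1 - p) * u powr p = k * (u / k) powr p" if "0 < k" "0 \<le> u" for k u :: real
      using that by (simp add: powr_divide powr_diff)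
    \<comment> \<open>\<open>m\<close> is the mean of \<open>x / (1 - l)\<close> and
      \<open>y / l\<close> with weights \<open>1 - l\<close> and \<open>l\<close>, so the linear
      terms of the two tangents at \<open>m\<close> cancel.\<close>
    have "m powr p = (1 - l) * (m powr p + p * m powr (p - 1) * (x / (1 - l) - m))
        + l * (m powr p + p * m powr (p - 1) * (y / l - m))"
    proof -
      have "(1 - l) * (x / (1 - l) - m) + l * (y / l - m) = 0"
        using l by (simp add: right_diff_distrib m_def) (simp add: algebra_simps)
      moreover have "(1 - l) * (P + c * A) + l * (P + c * B) = P + c * ((1 - l) * A + l * B)"
        for P c A B :: real by (simp add: algebra_simps)
      ultimately show ?thesis by simp
    qed
    also have "\<dots> \<le> (1 - l) * (x / (1 - l)) powr p + l * (y / l) powr p"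
      using l p m that by (intro add_mono mult_left_mono powr_above_tangent) auto
    finally show ?thesis unfolding m_def using s[of "1 - l" x] s[of l y] l that by simp
  qed
  have "(\<Sum>j<Suc N. a j) powr p = (a 0 + ?b) powr p"
    by (simp only: sum.lessThan_Suc_shift)
  also have "\<dots> \<le> (1 - l) powr (1 - p) * a 0 powr p + l powr (1 - p) * ?b powr p"
    using Suc.prems b by (intro two) auto
  also have "\<dots> \<le> (1 - l) powr (1 - p) * a 0 powr p + l powr (1 - p) *
      ((1 - l) powr (1 - p) * (\<Sum>j<N. (l powr (1 - p)) ^ j * a (Suc j) powr p))"
    using Suc.IH[of "\<lambda>j. a (Suc j)"] Suc.prems by (intro add_left_mono mult_left_mono) auto
  also have "\<dots> = (1 - l) powr (1 - p) * (\<Sum>j<Suc N. (l powr (1 - p)) ^ j * a j powr p)"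
    by (simp only: sum.lessThan_Suc_shift) (simp add: sum_distrib_left algebra_simps)
  finally show ?case .
qed simp

text \<open>The area mean is taken over the disk of radius \<open>D / 4\<close> about
  \<open>\<zeta>\<close>, where \<open>D = 2 ^ j * (1 - cmod z)\<close>. The hypotheses keep this
  disk inside the support of the kernel, whose value there is \<open>1 / D\<^sup>2\<close>; the
  ratio of \<open>D\<^sup>2\<close> to the area is \<open>16 / pi\<close>.\<close>

lemma ln_one_plus_cmod_powr_le_hardy_kernel:
  assumes p: "1 \<le> p" and h: "h holomorphic_on ball 0 1" and z: "cmod z < 1"
    and \<zeta>: "2 ^ j * (1 - cmod z) \<le> 2 * (1 - cmod \<zeta>)" "cmod (\<zeta> - z) \<le> 2 * (2 ^ j * (1 - cmod z))"
  shows "ennreal (ln (1 + cmod (h \<zeta>)) powr p) \<le>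
    ennreal (16 / pi) * (\<integral>\<^sup>+w. hardy_kernel j z w * ennreal (ln (1 + cmod (h w)) powr p) \<partial>lborel)"
proof -
  define D where "D = 2 ^ j * (1 - cmod z)"
  have D: "0 < D" using z by (simp add: D_def)
  let ?X = "ennreal (ln (1 + cmod (h \<zeta>)) powr p)"
  have sub: "cmod w < 1 \<and> D \<le> 4 * (1 - cmod w) \<and> cmod (w - z) < 3 * D" if "w \<in> cball \<zeta> (D / 4)" for w
  proof -
    have "cmod (w - \<zeta>) \<le> D / 4" using that by (simp add: dist_norm norm_minus_commute)
    then show ?thesis
      using norm_triangle_ineq[of "w - \<zeta>" "\<zeta> - z"] norm_triangle_ineq[of "w - \<zeta>" \<zeta>] \<zeta> D
      unfolding D_def[symmetric] by simp
  qed
  have "ennreal (pi * (D / 4)\<^sup>2) * ?X \<le>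
    (\<integral>\<^sup>+w. ennreal (ln (1 + cmod (h w)) powr p) * indicator (ball \<zeta> (D / 4)) w \<partial>lborel)"
    using D sub by (intro ln_one_plus_cmod_powr_area_mean[OF p h]) auto
  also have "\<dots> \<le> (\<integral>\<^sup>+w. ennreal (D\<^sup>2) * (hardy_kernel j z w * ennreal (ln (1 + cmod (h w)) powr p)) \<partial>lborel)"
  proof (intro nn_integral_mono)
    fix w
    show "ennreal (ln (1 + cmod (h w)) powr p) * indicator (ball \<zeta> (D / 4)) w
      \<le> ennreal (D\<^sup>2) * (hardy_kernel j z w * ennreal (ln (1 + cmod (h w)) powr p))"
    proof (cases "w \<in> ball \<zeta> (D / 4)")
      case True
      then have "w \<in> cball \<zeta> (D / 4)" using ball_subset_cball by blast
      then have "hardy_kernel j z w = ennreal (1 / D\<^sup>2)"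
        using sub[of w] z by (simp add: hardy_kernel_def D_def)
      moreover have "ennreal (D\<^sup>2) * ennreal (1 / D\<^sup>2) = 1"
        using D by (simp flip: ennreal_mult)
      ultimately show ?thesis using True by (simp add: mult.assoc[symmetric])
    qed simp
  qed
  also have "\<dots> = ennreal (D\<^sup>2) * (\<integral>\<^sup>+w. hardy_kernel j z w * ennreal (ln (1 + cmod (h w)) powr p) \<partial>lborel)"
  proof -
    have [measurable]: "(\<lambda>w. ennreal (ln (1 + cmod (h w)) powr p) * indicator (ball 0 1) w) \<in> borel_measurable borel"
      using p by (intro borel_measurable_ennreal_indicator_ball continuous_on_ln_one_plus_powr continuous_intros
          holomorphic_on_imp_continuous_on[OF h]) auto
    \<comment> \<open>The kernel vanishes off the unit disk, so the indicator can be inserted to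
      obtain measurability.\<close>
    have e: "hardy_kernel j z w * ennreal (ln (1 + cmod (h w)) powr p)
        = hardy_kernel j z w * (ennreal (ln (1 + cmod (h w)) powr p) * indicator (ball 0 1) w)" for w
      by (auto simp: hardy_kernel_def indicator_def)
    show ?thesis unfolding e by (intro nn_integral_cmult) measurable
  qed
  finally have "ennreal (16 / (pi * D\<^sup>2)) * (ennreal (pi * (D / 4)\<^sup>2) * ?X) \<le> ennreal (16 / (pi * D\<^sup>2)) *
      (ennreal (D\<^sup>2) * (\<integral>\<^sup>+w. hardy_kernel j z w * ennreal (ln (1 + cmod (h w)) powr p) \<partial>lborel))"
    by (rule mult_left_mono) simp
  moreover have "ennreal (16 / (pi * D\<^sup>2)) * ennreal (pi * (D / 4)\<^sup>2) = 1"
    using D by (simp add: power_divide flip: ennreal_mult)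
  moreover have "ennreal (16 / (pi * D\<^sup>2)) * ennreal (D\<^sup>2) = ennreal (16 / pi)"
    using D by (simp flip: ennreal_mult)
  ultimately show ?thesis by (simp add: mult.assoc[symmetric])
qed

section \<open>The pointwise estimates\<close>

text \<open>Cauchy's estimate on the circle of radius \<open>(1 - cmod z) / 2\<close> bounds
  \<open>(1 - cmod z) * cmod (deriv g z)\<close> by \<open>2 * cmod (g \<zeta>)\<close> at a point
  \<open>\<zeta>\<close> of maximum modulus. This point is admissible for the averaging lemma at
  scale \<open>j = 0\<close>.\<close>

lemma ln_deriv_powr_le_hardy_kernel:
  assumes p: "1 \<le> p" and g: "g holomorphic_on ball 0 1" and z: "cmod z < 1"
  shows "ennreal (ln (1 + (1 - cmod z) * cmod (deriv g z)) powr p) \<le>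
    ennreal (2 powr p * (16 / pi)) * (\<integral>\<^sup>+w. hardy_kernel 0 z w * ennreal (ln (1 + cmod (g w)) powr p) \<partial>lborel)"
proof -
  define r where "r = (1 - cmod z) / 2"
  have r: "0 < r" using z by (simp add: r_def)
  have sub: "cball z r \<subseteq> ball 0 1"
  proof
    fix w assume "w \<in> cball z r"
    then show "w \<in> ball 0 1"
      using norm_triangle_ineq[of z "w - z"] z by (simp add: dist_norm norm_minus_commute r_def field_simps)
  qed
  have c: "continuous_on (cball z r) g"
    using holomorphic_on_imp_continuous_on[OF g] sub continuous_on_subset by blast
  have "compact (sphere z r)" "sphere z r \<noteq> {}" using r by auto
  moreover have "continuous_on (sphere z r) (\<lambda>w. cmod (g w))"
    using c by (intro continuous_intros) (auto elim: continuous_on_subset)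
  ultimately obtain \<zeta> where \<zeta>: "\<zeta> \<in> sphere z r" "\<And>w. w \<in> sphere z r \<Longrightarrow> cmod (g w) \<le> cmod (g \<zeta>)"
    using continuous_attains_sup[of "sphere z r" "\<lambda>w. cmod (g w)"] by blast
  have "cmod ((deriv ^^ 1) g z) \<le> fact 1 * cmod (g \<zeta>) / r ^ 1"
  proof (rule Cauchy_inequality)
    show "g holomorphic_on ball z r"
      by (rule holomorphic_on_subset[OF g]) (use sub ball_subset_cball[of z r] in blast)
  qed (use c r \<zeta>(2) in \<open>auto simp: dist_norm\<close>)
  then have "(1 - cmod z) * cmod (deriv g z) \<le> 2 * cmod (g \<zeta>)"
    using r by (simp add: r_def field_simps)
  then have "ln (1 + (1 - cmod z) * cmod (deriv g z)) \<le> ln (1 + 2 * cmod (g \<zeta>))"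
    using z by (intro ln_mono) (auto simp: add_pos_nonneg)
  also have "\<dots> \<le> 2 * ln (1 + cmod (g \<zeta>))"
    by (intro ln_one_plus_mult_le) auto
  finally have "ln (1 + (1 - cmod z) * cmod (deriv g z)) powr p \<le> (2 * ln (1 + cmod (g \<zeta>))) powr p"
    using p z by (intro powr_mono2) auto
  also have "\<dots> = 2 powr p * ln (1 + cmod (g \<zeta>)) powr p"
    by (simp add: powr_mult)
  finally have "ennreal (ln (1 + (1 - cmod z) * cmod (deriv g z)) powr p)
      \<le> ennreal (2 powr p) * ennreal (ln (1 + cmod (g \<zeta>)) powr p)"
    by (simp add: ennreal_leI flip: ennreal_mult)
  also have "\<dots> \<le> ennreal (2 powr p) * (ennreal (16 / pi) *
      (\<integral>\<^sup>+w. hardy_kernel 0 z w * ennreal (ln (1 + cmod (g w)) powr p) \<partial>lborel))"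
  proof (intro mult_left_mono ln_one_plus_cmod_powr_le_hardy_kernel[OF p g z])
    have "cmod (\<zeta> - z) = r" using \<zeta> by (simp add: dist_norm norm_minus_commute)
    then show "2 ^ 0 * (1 - cmod z) \<le> 2 * (1 - cmod \<zeta>)" "cmod (\<zeta> - z) \<le> 2 * (2 ^ 0 * (1 - cmod z))"
      using norm_triangle_ineq[of z "\<zeta> - z"] z by (auto simp: r_def field_simps)
  qed simp
  finally show ?thesis by (subst ennreal_mult) (simp_all add: mult.assoc)
qed

text \<open>
  The step from index \<open>j\<close> to \<open>j + 1\<close> has length about \<open>2\<^sup>j (1 - |z|)\<close>; the chain starts at \<open>z\<close>
  and is eventually \<open>0\<close>.
\<close>
definition radial_chain :: "complex \<Rightarrow> nat \<Rightarrow> complex" where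
  "radial_chain z j = of_real (max 0 (1 - (2 ^ j - 1) * (1 - cmod z))) * z"

text \<open>The increment is at most the length of the step times the maximum of the derivative on
  the segment. The segment stays at distance at least \<open>D / 2\<close> from the unit circle and
  within \<open>2 * D\<close> of \<open>z\<close>, as the averaging lemma asks.\<close>

lemma ln_radial_chain_step_powr_le_hardy_kernel:
  assumes p: "1 \<le> p" and g: "g holomorphic_on ball 0 1" and z: "cmod z < 1"
  shows "ennreal (ln (1 + cmod (g (radial_chain z j) - g (radial_chain z (Suc j)))) powr p) \<le>
    ennreal (4 powr p * (16 / pi)) *
      (\<integral>\<^sup>+w. hardy_kernel j z w * ennreal (ln (1 + (1 - cmod w) * cmod (deriv g w)) powr p) \<partial>lborel)"
proof (cases "(2 ^ j - 1) * (1 - cmod z) < 1")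
  case False
  then have "1 \<le> (2 ^ j - 1) * (1 - cmod z)" by simp
  also have "\<dots> \<le> (2 ^ Suc j - 1) * (1 - cmod z)" using z by (intro mult_right_mono) auto
  finally have "radial_chain z j = 0" "radial_chain z (Suc j) = 0"
    using False by (auto simp: radial_chain_def max_def)
  then show ?thesis by simp
next
  case True
  define d where "d = 1 - cmod z"
  define D where "D = 2 ^ j * d"
  define s where "s = max 0 (1 - (2 ^ Suc j - 1) * d)"
  define t where "t = 1 - (2 ^ j - 1) * d"
  have d: "0 < d" "d \<le> 1" using z by (auto simp: d_def)
  have D: "0 < D" using d by (simp add: D_def)
  have chain: "radial_chain z j = of_real t * z" "radial_chain z (Suc j) = of_real s * z"
    using True by (auto simp: radial_chain_def s_def t_def d_def)
  have t_eq: "t = 1 - (D - d)" by (simp add: t_def D_def algebra_simps)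
  have s_eq: "s = max 0 (1 - (2 * D - d))" by (simp add: s_def D_def algebra_simps)
  then have sD: "1 - (2 * D - d) \<le> s" by simp
  have st: "s \<le> t" "0 \<le> s" "t \<le> 1" "t - s \<le> D" "1 - s \<le> 2 * D"
  proof -
    show "0 \<le> s" by (simp add: s_def)
    show "t \<le> 1" using d by (simp add: t_def)
    show "t - s \<le> D" "1 - s \<le> 2 * D" using sD d t_eq by linarith+
    have "0 \<le> t" using True by (simp add: t_def d_def)
    then show "s \<le> t" using D t_eq by (simp add: s_eq)
  qed
  let ?S = "closed_segment (radial_chain z j) (radial_chain z (Suc j))"
  have on_segment: "D \<le> 2 * (1 - cmod \<zeta>) \<and> cmod (\<zeta> - z) \<le> 2 * D" if "\<zeta> \<in> ?S" for \<zeta>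
  proof -
    from that obtain u where u: "0 \<le> u" "u \<le> 1"
        "\<zeta> = (1 - u) *\<^sub>R radial_chain z j + u *\<^sub>R radial_chain z (Suc j)"
      by (auto simp: in_segment)
    define k where "k = (1 - u) * t + u * s"
    have \<zeta>: "\<zeta> = of_real k * z"
      by (simp add: u(3) chain k_def scaleR_conv_of_real algebra_simps)
    have k: "s \<le> k" "k \<le> t"
    proof -
      have "k = t - u * (t - s)" "k = s + (1 - u) * (t - s)" by (simp_all add: k_def algebra_simps)
      moreover have "0 \<le> u * (t - s)" "0 \<le> (1 - u) * (t - s)"
        using u st by (simp_all only: mult_nonneg_nonneg diff_ge_0_iff_ge)
      ultimately show "s \<le> k" "k \<le> t" by simp_all
    qed
    have "cmod (\<zeta> - z) = (1 - k) * cmod z"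
    proof -
      have "\<zeta> - z = - (of_real (1 - k) * z)" by (simp add: \<zeta> algebra_simps)
      then show ?thesis using k st by (simp only: norm_minus_cancel norm_mult norm_of_real)
    qed
    also have "\<dots> \<le> (1 - k) * 1" using k st z by (intro mult_left_mono) auto
    also have "\<dots> \<le> 2 * D" using k st by simp
    finally have 1: "cmod (\<zeta> - z) \<le> 2 * D" .
    have "cmod \<zeta> = k * (1 - d)" using k st by (simp add: \<zeta> norm_mult d_def)
    also have "\<dots> \<le> t * (1 - d)" using k d by (intro mult_right_mono) auto
    also have "\<dots> = 1 - D + (2 ^ j - 1) * d * d" by (simp add: t_def D_def algebra_simps)
    finally have "D - (2 ^ j - 1) * d * d \<le> 1 - cmod \<zeta>" by simp
    \<comment> \<open>The chain points are multiples of \<open>z\<close>, so their moduli carry this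
      error term. For \<open>j > 0\<close> the case assumption bounds \<open>(2 ^ j - 1) * d\<close>
      by 1, which is at most \<open>2 ^ (j - 1)\<close>; for \<open>j = 0\<close> the term
      vanishes.\<close>
    moreover have "(2 ^ j - 1) * d * d \<le> D / 2"
    proof -
      have "(2 ^ j - 1) * d \<le> 2 ^ j / 2"
      proof (cases j)
        case (Suc i)
        have "(2 ^ j - 1) * d \<le> 1" using True by (simp add: d_def)
        also have "1 \<le> (2::real) ^ i" by simp
        finally show ?thesis by (simp add: Suc)
      qed simp
      from mult_right_mono[OF this, of d] show ?thesis using d by (simp add: D_def)
    qed
    ultimately show ?thesis using 1 by simp
  qed
  have S: "?S \<subseteq> ball 0 1" using on_segment D by force
  have dg: "deriv g holomorphic_on ball 0 1" using g by (intro holomorphic_deriv) auto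
  have "continuous_on ?S (\<lambda>w. cmod (deriv g w))"
    using holomorphic_on_imp_continuous_on[OF dg] S by (intro continuous_intros) (auto elim: continuous_on_subset)
  then obtain \<zeta> where \<zeta>: "\<zeta> \<in> ?S" "\<And>w. w \<in> ?S \<Longrightarrow> cmod (deriv g w) \<le> cmod (deriv g \<zeta>)"
    using continuous_attains_sup[of ?S "\<lambda>w. cmod (deriv g w)"] by auto
  have "cmod (g (radial_chain z j) - g (radial_chain z (Suc j)))
      \<le> cmod (deriv g \<zeta>) * cmod (radial_chain z j - radial_chain z (Suc j))"
  proof (rule field_differentiable_bound[of ?S])
    show "(g has_field_derivative deriv g w) (at w within ?S)" if "w \<in> ?S" for w
      using holomorphic_derivI[OF g] S that by (auto intro: has_field_derivative_at_within)
  qed (use \<zeta> in auto)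
  also have "\<dots> \<le> cmod (deriv g \<zeta>) * D"
  proof (intro mult_left_mono)
    have "radial_chain z j - radial_chain z (Suc j) = of_real (t - s) * z"
      by (simp add: chain algebra_simps)
    then have "cmod (radial_chain z j - radial_chain z (Suc j)) = (t - s) * cmod z"
      using st by (simp only: norm_mult norm_of_real)
    also have "\<dots> \<le> (t - s) * 1" using st z by (intro mult_left_mono) auto
    finally show "cmod (radial_chain z j - radial_chain z (Suc j)) \<le> D" using st by simp
  qed simp
  \<comment> \<open>The averaging lemma requires an analytic function, so \<open>D\<close> enters as
    a constant factor. It is replaced by \<open>1 - cmod w\<close> only after averaging, where the
    kernel guarantees \<open>D \<le> 4 * (1 - cmod w)\<close>.\<close>
  also have "\<dots> = cmod (of_real D * deriv g \<zeta>)" using D by (simp add: norm_mult)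
  finally have "ln (1 + cmod (g (radial_chain z j) - g (radial_chain z (Suc j)))) powr p
      \<le> ln (1 + cmod (of_real D * deriv g \<zeta>)) powr p"
    using p by (intro powr_mono2 ln_mono) (auto simp: add_pos_nonneg)
  then have "ennreal (ln (1 + cmod (g (radial_chain z j) - g (radial_chain z (Suc j)))) powr p)
      \<le> ennreal (ln (1 + cmod (of_real D * deriv g \<zeta>)) powr p)"
    by (rule ennreal_leI)
  also have "\<dots> \<le> ennreal (16 / pi) *
      (\<integral>\<^sup>+w. hardy_kernel j z w * ennreal (ln (1 + cmod (of_real D * deriv g w)) powr p) \<partial>lborel)"
    using on_segment[OF \<zeta>(1)]
    by (intro ln_one_plus_cmod_powr_le_hardy_kernel[OF p _ z] holomorphic_intros dg) (auto simp: D_def d_def)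
  also have "\<dots> \<le> ennreal (16 / pi) * (\<integral>\<^sup>+w. ennreal (4 powr p) *
      (hardy_kernel j z w * (ennreal (ln (1 + (1 - cmod w) * cmod (deriv g w)) powr p) * indicator (ball 0 1) w)) \<partial>lborel)"
  proof (intro mult_left_mono nn_integral_mono)
    fix w
    show "hardy_kernel j z w * ennreal (ln (1 + cmod (of_real D * deriv g w)) powr p) \<le> ennreal (4 powr p) *
      (hardy_kernel j z w * (ennreal (ln (1 + (1 - cmod w) * cmod (deriv g w)) powr p) * indicator (ball 0 1) w))"
    proof (cases "hardy_kernel j z w = 0")
      case False
      then have w: "cmod w < 1" "D \<le> 4 * (1 - cmod w)"
        by (auto simp: hardy_kernel_def D_def d_def split: if_splits)
      have "ln (1 + cmod (of_real D * deriv g w)) \<le> ln (1 + 4 * ((1 - cmod w) * cmod (deriv g w)))"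
        using D w mult_right_mono[OF w(2), of "cmod (deriv g w)"]
        by (intro ln_mono) (simp_all add: norm_mult add_pos_nonneg algebra_simps)
      also have "\<dots> \<le> 4 * ln (1 + (1 - cmod w) * cmod (deriv g w))"
        using w by (intro ln_one_plus_mult_le) auto
      finally have "ln (1 + cmod (of_real D * deriv g w)) powr p \<le> (4 * ln (1 + (1 - cmod w) * cmod (deriv g w))) powr p"
        using p by (intro powr_mono2) auto
      also have "\<dots> = 4 powr p * ln (1 + (1 - cmod w) * cmod (deriv g w)) powr p"
        by (simp add: powr_mult)
      finally have "ennreal (ln (1 + cmod (of_real D * deriv g w)) powr p)
          \<le> ennreal (4 powr p) * ennreal (ln (1 + (1 - cmod w) * cmod (deriv g w)) powr p)"
        by (simp add: ennreal_leI flip: ennreal_mult)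
      from mult_left_mono[OF this, of "hardy_kernel j z w"] w show ?thesis
        by (simp add: mult.left_commute)
    qed simp
  qed simp
  also have "\<dots> = ennreal (16 / pi) * (ennreal (4 powr p) * (\<integral>\<^sup>+w. hardy_kernel j z w *
      (ennreal (ln (1 + (1 - cmod w) * cmod (deriv g w)) powr p) * indicator (ball 0 1) w) \<partial>lborel))"
  proof -
    have [measurable]: "(\<lambda>w. ennreal (ln (1 + (1 - cmod w) * cmod (deriv g w)) powr p) * indicator (ball 0 1) w)
        \<in> borel_measurable borel"
      using p by (intro borel_measurable_ennreal_indicator_ball continuous_on_ln_one_plus_powr continuous_intros
          holomorphic_on_imp_continuous_on[OF dg]) auto
    show ?thesis by (subst nn_integral_cmult) auto
  qed
  also have "(\<integral>\<^sup>+w. hardy_kernel j z w *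
      (ennreal (ln (1 + (1 - cmod w) * cmod (deriv g w)) powr p) * indicator (ball 0 1) w) \<partial>lborel)
      = (\<integral>\<^sup>+w. hardy_kernel j z w * ennreal (ln (1 + (1 - cmod w) * cmod (deriv g w)) powr p) \<partial>lborel)"
    by (intro nn_integral_cong) (auto simp: hardy_kernel_def indicator_def)
  finally show ?thesis by (subst ennreal_mult) (simp_all add: mult_ac)
qed

text \<open>The steps of the chain telescope to \<open>g z - g 0\<close>, and
  \<open>powr_sum_le_geometric\<close> distributes the power. The number of steps depends on
  \<open>z\<close>, hence the full series on the right.\<close>

lemma ln_diff_powr_le_hardy_kernel_suminf:
  assumes p: "1 \<le> p" and l: "0 < l" "l < 1" and g: "g holomorphic_on ball 0 1" and z: "cmod z < 1"
  shows "ennreal (ln (1 + cmod (g z - g 0)) powr p) \<le>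
    (\<Sum>j. ennreal ((1 - l) powr (1 - p) * (4 powr p * (16 / pi)) * (l powr (1 - p)) ^ j) *
      (\<integral>\<^sup>+w. hardy_kernel j z w * ennreal (ln (1 + (1 - cmod w) * cmod (deriv g w)) powr p) \<partial>lborel))"
proof -
  define x where "x j = g (radial_chain z j) - g (radial_chain z (Suc j))" for j
  define a where "a j = ln (1 + cmod (x j))" for j
  have a: "0 \<le> a j" for j by (simp add: a_def)
  obtain N where N: "1 / (1 - cmod z) + 1 < 2 ^ N"
    using real_arch_pow[of 2 "1 / (1 - cmod z) + 1"] by auto
  have "radial_chain z N = 0"
  proof -
    have "1 \<le> (2 ^ N - 1) * (1 - cmod z)" using N z by (simp add: field_simps)
    then show ?thesis by (simp add: radial_chain_def max_def)
  qed
  moreover have "radial_chain z 0 = z" by (simp add: radial_chain_def)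
  ultimately have "g z - g 0 = (\<Sum>j<N. x j)"
    unfolding x_def by (subst sum_lessThan_telescope') simp
  then have "ln (1 + cmod (g z - g 0)) \<le> (\<Sum>j<N. a j)"
    unfolding a_def using ln_one_plus_cmod_sum_le by simp
  then have "ln (1 + cmod (g z - g 0)) powr p \<le> (\<Sum>j<N. a j) powr p"
    using p by (intro powr_mono2) auto
  also have "\<dots> \<le> (1 - l) powr (1 - p) * (\<Sum>j<N. (l powr (1 - p)) ^ j * a j powr p)"
    by (rule powr_sum_le_geometric[OF p l a])
  finally have "ennreal (ln (1 + cmod (g z - g 0)) powr p) \<le>
      ennreal (\<Sum>j<N. (1 - l) powr (1 - p) * (l powr (1 - p)) ^ j * a j powr p)"
    by (simp add: ennreal_leI sum_distrib_left mult.assoc)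
  also have "\<dots> = (\<Sum>j<N. ennreal ((1 - l) powr (1 - p) * (l powr (1 - p)) ^ j) * ennreal (a j powr p))"
    by (simp add: ennreal_mult flip: sum_ennreal)
  also have "\<dots> \<le> (\<Sum>j<N. ennreal ((1 - l) powr (1 - p) * (4 powr p * (16 / pi)) * (l powr (1 - p)) ^ j) *
      (\<integral>\<^sup>+w. hardy_kernel j z w * ennreal (ln (1 + (1 - cmod w) * cmod (deriv g w)) powr p) \<partial>lborel))"
  proof (intro sum_mono)
    fix j
    let ?I = "\<integral>\<^sup>+w. hardy_kernel j z w * ennreal (ln (1 + (1 - cmod w) * cmod (deriv g w)) powr p) \<partial>lborel"
    have "ennreal ((1 - l) powr (1 - p) * (l powr (1 - p)) ^ j) * ennreal (a j powr p)
      \<le> ennreal ((1 - l) powr (1 - p) * (l powr (1 - p)) ^ j) * (ennreal (4 powr p * (16 / pi)) * ?I)"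
      unfolding a_def x_def
      by (intro mult_left_mono ln_radial_chain_step_powr_le_hardy_kernel[OF p g z]) simp
    also have "\<dots> = ennreal (((1 - l) powr (1 - p) * (l powr (1 - p)) ^ j) * (4 powr p * (16 / pi))) * ?I"
      by (subst (3) ennreal_mult) (simp_all add: mult.assoc)
    also have "((1 - l) powr (1 - p) * (l powr (1 - p)) ^ j) * (4 powr p * (16 / pi))
        = (1 - l) powr (1 - p) * (4 powr p * (16 / pi)) * (l powr (1 - p)) ^ j"
      by simp
    finally show "ennreal ((1 - l) powr (1 - p) * (l powr (1 - p)) ^ j) * ennreal (a j powr p) \<le>
        ennreal ((1 - l) powr (1 - p) * (4 powr p * (16 / pi)) * (l powr (1 - p)) ^ j) * ?I" .
  qed
  also have "\<dots> \<le> (\<Sum>j. ennreal ((1 - l) powr (1 - p) * (4 powr p * (16 / pi)) * (l powr (1 - p)) ^ j) *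
      (\<integral>\<^sup>+w. hardy_kernel j z w * ennreal (ln (1 + (1 - cmod w) * cmod (deriv g w)) powr p) \<partial>lborel))"
    by (intro sum_le_suminf) auto
  finally show ?thesis .
qed

text \<open>Term by term integration contributes \<open>s ^ j\<close> against the coefficient
  \<open>q ^ j\<close>, leaving a geometric series of ratio \<open>q * s\<close>. Both directions of
  the theorem pass through this lemma.\<close>

lemma nn_integral_disk_weight_le_of_hardy_kernel_suminf:
  fixes \<alpha> c q :: real
  defines "K \<equiv> 64 * 64 * 144 * pi * 4 powr \<bar>\<alpha>\<bar>" and "s \<equiv> 2 powr - (\<alpha> + 1)"
  assumes F: "(\<lambda>w. F w * indicator (ball 0 1) w) \<in> borel_measurable borel"
    and c: "0 \<le> c" and q: "0 \<le> q" "q * s < 1"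
    and \<Phi>: "\<And>z. cmod z < 1 \<Longrightarrow> \<Phi> z \<le> (\<Sum>j. ennreal (c * q ^ j) * (\<integral>\<^sup>+w. hardy_kernel j z w * F w \<partial>lborel))"
  shows "(\<integral>\<^sup>+z. disk_weight \<alpha> z * \<Phi> z \<partial>lborel) \<le>
    ennreal (c * K / (1 - q * s)) * (\<integral>\<^sup>+z. disk_weight \<alpha> z * F z \<partial>lborel)"
proof -
  define G where "G = (\<lambda>w. F w * indicator (ball 0 1) w)"
  have [measurable]: "G \<in> borel_measurable borel" using F by (simp add: G_def)
  have s: "0 \<le> s" and K: "0 \<le> K" by (simp_all add: s_def K_def)
  have kG: "hardy_kernel j z w * F w = hardy_kernel j z w * G w" for j z w
    by (auto simp: G_def hardy_kernel_def indicator_def)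
  have "(\<integral>\<^sup>+z. disk_weight \<alpha> z * \<Phi> z \<partial>lborel) \<le>
      (\<integral>\<^sup>+z. disk_weight \<alpha> z * (\<Sum>j. ennreal (c * q ^ j) * (\<integral>\<^sup>+w. hardy_kernel j z w * G w \<partial>lborel)) \<partial>lborel)"
  proof (rule nn_integral_mono)
    fix z
    show "disk_weight \<alpha> z * \<Phi> z \<le>
      disk_weight \<alpha> z * (\<Sum>j. ennreal (c * q ^ j) * (\<integral>\<^sup>+w. hardy_kernel j z w * G w \<partial>lborel))"
    proof (cases "cmod z < 1")
      case True
      then show ?thesis using \<Phi>[OF True] by (intro mult_left_mono) (simp_all add: kG)
    qed (simp add: disk_weight_def)
  qed
  also have "\<dots> = (\<integral>\<^sup>+z. (\<Sum>j. ennreal (c * q ^ j) * (disk_weight \<alpha> z * (\<integral>\<^sup>+w. hardy_kernel j z w * G w \<partial>lborel))) \<partial>lborel)"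
    by (simp add: ennreal_suminf_cmult[symmetric] mult.left_commute del: ennreal_suminf_cmult)
  also have "\<dots> = (\<Sum>j. ennreal (c * q ^ j) * (\<integral>\<^sup>+z. disk_weight \<alpha> z * (\<integral>\<^sup>+w. hardy_kernel j z w * G w \<partial>lborel) \<partial>lborel))"
    by (subst nn_integral_suminf) (simp_all add: nn_integral_cmult)
  also have "\<dots> \<le> (\<Sum>j. ennreal (c * q ^ j) * (ennreal (K * s ^ j) * (\<integral>\<^sup>+z. disk_weight \<alpha> z * G z \<partial>lborel)))"
    unfolding K_def s_def
    by (intro suminf_le mult_left_mono nn_integral_disk_weight_hardy_kernel_le) auto
  also have "\<dots> = (\<Sum>j. ennreal (c * K * (q * s) ^ j) * (\<integral>\<^sup>+z. disk_weight \<alpha> z * G z \<partial>lborel))"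
  proof -
    have "ennreal (c * K * (q * s) ^ j) = ennreal (c * q ^ j) * ennreal (K * s ^ j)" for j
      using c q K s by (simp add: power_mult_distrib mult_ac flip: ennreal_mult)
    then show ?thesis by (simp add: mult.assoc)
  qed
  also have "\<dots> = (\<Sum>j. ennreal (c * K * (q * s) ^ j)) * (\<integral>\<^sup>+z. disk_weight \<alpha> z * G z \<partial>lborel)"
    by simp
  also have "(\<Sum>j. ennreal (c * K * (q * s) ^ j)) = ennreal (c * K / (1 - q * s))"
  proof -
    have "(\<lambda>j. c * K * (q * s) ^ j) sums (c * K * (1 / (1 - q * s)))"
      using q s by (intro sums_mult geometric_sums) auto
    then show ?thesis using c K q s by (intro suminf_ennreal_eq) auto
  qed
  also have "(\<integral>\<^sup>+z. disk_weight \<alpha> z * G z \<partial>lborel) = (\<integral>\<^sup>+z. disk_weight \<alpha> z * F z \<partial>lborel)"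
    by (intro nn_integral_cong) (auto simp: G_def disk_weight_def indicator_def)
  finally show ?thesis .
qed

section \<open>The weighted area measure\<close>

lemma nn_integral_weighted_area:
  assumes "(\<lambda>z. F z * indicator (ball 0 1) z) \<in> borel_measurable borel"
  shows "(\<integral>\<^sup>+z. F z \<partial>weighted_area \<alpha>) =
    (\<integral>\<^sup>+z. ennreal (1 / pi) * (ennreal ((1 + \<alpha>) * (1 - (cmod z)\<^sup>2) powr \<alpha>) * F z) * indicator (ball 0 1) z \<partial>lborel)"
proof -
  let ?R = "restrict_space lborel (ball (0::complex) 1)"
  have [measurable]: "F \<in> borel_measurable ?R"
    using assms by (subst borel_measurable_restrict_space_iff_ennreal) auto
  have [measurable]: "(\<lambda>z. ennreal ((1 + \<alpha>) * (1 - (cmod z)\<^sup>2) powr \<alpha>)) \<in> borel_measurable ?R"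
    by (intro measurable_restrict_space1) measurable
  have "(\<integral>\<^sup>+z. F z \<partial>weighted_area \<alpha>) =
      (\<integral>\<^sup>+z. ennreal ((1 + \<alpha>) * (1 - (cmod z)\<^sup>2) powr \<alpha>) * F z \<partial>area_measure)"
    unfolding weighted_area_def by (intro nn_integral_density) (simp_all add: area_measure_def)
  also have "\<dots> = (\<integral>\<^sup>+z. ennreal (1 / pi) * (ennreal ((1 + \<alpha>) * (1 - (cmod z)\<^sup>2) powr \<alpha>) * F z) \<partial>?R)"
    unfolding area_measure_def by (intro nn_integral_density) simp_all
  also have "\<dots> = (\<integral>\<^sup>+z. ennreal (1 / pi) * (ennreal ((1 + \<alpha>) * (1 - (cmod z)\<^sup>2) powr \<alpha>) * F z) * indicator (ball 0 1) z \<partial>lborel)"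
    by (intro nn_integral_restrict_space) auto
  finally show ?thesis .
qed

text \<open>The densities differ by the factor
  \<open>(1 + \<alpha>) / pi * (1 + cmod z) powr \<alpha>\<close>, and \<open>1 + cmod z\<close>
  lies between 1 and 2. Adding \<open>(1 + \<alpha>) / pi\<close> and its reciprocal gives one
  constant for both directions.\<close>

lemma nn_integral_weighted_area_bounds:
  fixes \<alpha> :: real
  defines "A \<equiv> ((1 + \<alpha>) / pi + pi / (1 + \<alpha>)) * 2 powr \<bar>\<alpha>\<bar>"
  assumes \<alpha>: "-1 < \<alpha>" and F: "(\<lambda>z. F z * indicator (ball 0 1) z) \<in> borel_measurable borel"
  shows "(\<integral>\<^sup>+z. F z \<partial>weighted_area \<alpha>) \<le> ennreal A * (\<integral>\<^sup>+z. disk_weight \<alpha> z * F z \<partial>lborel)"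
    and "(\<integral>\<^sup>+z. disk_weight \<alpha> z * F z \<partial>lborel) \<le> ennreal A * (\<integral>\<^sup>+z. F z \<partial>weighted_area \<alpha>)"
proof -
  define G where "G = (\<lambda>z. F z * indicator (ball 0 1) z)"
  have [measurable]: "G \<in> borel_measurable borel" using F by (simp add: G_def)
  define v where "v z = 1 / pi * ((1 + \<alpha>) * (1 - (cmod z)\<^sup>2) powr \<alpha>)" for z
  have [measurable]: "v \<in> borel_measurable borel" unfolding v_def by measurable
  have v: "0 \<le> v z" for z using \<alpha> by (simp add: v_def)
  have A: "0 \<le> A" using \<alpha> by (simp add: A_def)
  have W: "(\<integral>\<^sup>+z. F z \<partial>weighted_area \<alpha>) = (\<integral>\<^sup>+z. ennreal (v z) * G z \<partial>lborel)"
    unfolding nn_integral_weighted_area[OF F] v_def G_def using \<alpha>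
    by (intro nn_integral_cong, subst (2) ennreal_mult) (simp_all add: mult.assoc)
  have L: "(\<integral>\<^sup>+z. disk_weight \<alpha> z * F z \<partial>lborel) = (\<integral>\<^sup>+z. disk_weight \<alpha> z * G z \<partial>lborel)"
    by (intro nn_integral_cong) (auto simp: G_def disk_weight_def indicator_def)
  have bounds: "v z \<le> A * (1 - cmod z) powr \<alpha>" "(1 - cmod z) powr \<alpha> \<le> A * v z" if z: "cmod z < 1" for z
  proof -
    define k where "k = (1 + \<alpha>) / pi"
    define E where "E = (1 + cmod z) powr \<alpha>"
    define B where "B = 2 powr \<bar>\<alpha>\<bar>"
    define d where "d = (1 - cmod z) powr \<alpha>"
    have pos: "0 < k" "0 < B" "0 \<le> d" using \<alpha> by (auto simp: k_def B_def d_def)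
    have "1 - (cmod z)\<^sup>2 = (1 - cmod z) * (1 + cmod z)" by (simp add: power2_eq_square algebra_simps)
    then have v_eq: "v z = k * E * d" using z by (simp add: v_def k_def E_def d_def powr_mult)
    have "ln (1 + cmod z) \<le> ln 2" "0 \<le> ln (1 + cmod z)" using z
      by (simp_all add: add_pos_nonneg)
    then have "\<bar>\<alpha> * ln (1 + cmod z)\<bar> \<le> \<bar>\<alpha>\<bar> * ln 2"
      unfolding abs_mult by (intro mult_left_mono) auto
    then have "\<alpha> * ln (1 + cmod z) \<le> \<bar>\<alpha>\<bar> * ln 2" "- (\<bar>\<alpha>\<bar> * ln 2) \<le> \<alpha> * ln (1 + cmod z)"
      by linarith+
    moreover have nz: "1 + cmod z \<noteq> 0" by (smt (verit) norm_ge_zero)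
    ultimately have E: "E \<le> B" "inverse B \<le> E"
      using nz by (auto simp: E_def B_def powr_def simp flip: exp_minus)
    have AkB: "A = (k + 1 / k) * B" by (simp add: A_def k_def B_def)
    have "k * E \<le> k * B" using E pos by simp
    also have "\<dots> \<le> A" using pos by (simp add: AkB distrib_right)
    finally show "v z \<le> A * (1 - cmod z) powr \<alpha>"
      unfolding v_eq d_def[symmetric] using pos by (intro mult_right_mono) auto
    have "1 = 1 / k * B * (k * inverse B)" using pos by simp
    also have "\<dots> \<le> A * (k * E)"
      using E pos by (intro mult_mono) (auto simp: AkB distrib_right)
    finally have "1 * d \<le> A * (k * E) * d" using pos by (intro mult_right_mono) auto
    then show "(1 - cmod z) powr \<alpha> \<le> A * v z" by (simp add: v_eq d_def mult.assoc)
  qed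
  have "(\<integral>\<^sup>+z. ennreal (v z) * G z \<partial>lborel) \<le> (\<integral>\<^sup>+z. ennreal A * (disk_weight \<alpha> z * G z) \<partial>lborel)"
  proof (rule nn_integral_mono)
    fix z
    show "ennreal (v z) * G z \<le> ennreal A * (disk_weight \<alpha> z * G z)"
    proof (cases "cmod z < 1")
      case True
      have "ennreal (v z) \<le> ennreal A * ennreal ((1 - cmod z) powr \<alpha>)"
        using bounds(1)[OF True] A by (simp add: ennreal_leI flip: ennreal_mult)
      from mult_right_mono[OF this, of "G z"] True show ?thesis
        by (simp add: disk_weight_def mult.assoc)
    qed (simp add: G_def)
  qed
  also have "\<dots> = ennreal A * (\<integral>\<^sup>+z. disk_weight \<alpha> z * G z \<partial>lborel)"
    by (intro nn_integral_cmult) simp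
  finally show "(\<integral>\<^sup>+z. F z \<partial>weighted_area \<alpha>) \<le> ennreal A * (\<integral>\<^sup>+z. disk_weight \<alpha> z * F z \<partial>lborel)"
    unfolding W L .
  have "(\<integral>\<^sup>+z. disk_weight \<alpha> z * G z \<partial>lborel) \<le> (\<integral>\<^sup>+z. ennreal A * (ennreal (v z) * G z) \<partial>lborel)"
  proof (rule nn_integral_mono)
    fix z
    show "disk_weight \<alpha> z * G z \<le> ennreal A * (ennreal (v z) * G z)"
    proof (cases "cmod z < 1")
      case True
      have "ennreal ((1 - cmod z) powr \<alpha>) \<le> ennreal A * ennreal (v z)"
        using bounds(2)[OF True] A v by (simp add: ennreal_leI flip: ennreal_mult)
      from mult_right_mono[OF this, of "G z"] True show ?thesis
        by (simp add: disk_weight_def mult.assoc)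
    qed (simp add: G_def)
  qed
  also have "\<dots> = ennreal A * (\<integral>\<^sup>+z. ennreal (v z) * G z \<partial>lborel)"
    by (intro nn_integral_cmult) simp
  finally show "(\<integral>\<^sup>+z. disk_weight \<alpha> z * F z \<partial>lborel) \<le> ennreal A * (\<integral>\<^sup>+z. F z \<partial>weighted_area \<alpha>)"
    unfolding W L .
qed

section \<open>From the weighted integrals to \<open>N_norm\<close>\<close>

text \<open>Root and power cancel on all of \<open>[0, \<infinity>]\<close>, the infinite value
  included, so the theorem compares two integrals.\<close>

lemma ennreal_powr_N_norm:
  assumes "1 \<le> p"
  shows "ennreal_powr (N_norm p \<alpha> h) p = (\<integral>\<^sup>+ z. ennreal (ln (1 + cmod (h z)) powr p) \<partial>weighted_area \<alpha>)"
proof -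
  have "ennreal_powr (ennreal_powr x (1 / p)) p = x" for x
    using assms by (cases x) (auto simp: ennreal_powr_def powr_powr)
  then show ?thesis by (simp add: N_norm_def)
qed

theorem theorem1p1:
  fixes p \<alpha> :: real
  assumes "1 \<le> p" and "-1 < \<alpha>"
  shows "\<exists>C::real. 1 \<le> C \<and>
    (\<forall>f. f analytic_on unit_disk \<longrightarrow>
      ennreal (inverse C) * ennreal_powr (N_norm p \<alpha> (\<lambda>z. f z - f 0)) p
        \<le> (\<integral>\<^sup>+ z. ennreal (ln (1 + (1 - cmod z) * cmod (deriv f z)) powr p) \<partial>weighted_area \<alpha>) \<and>
      (\<integral>\<^sup>+ z. ennreal (ln (1 + (1 - cmod z) * cmod (deriv f z)) powr p) \<partial>weighted_area \<alpha>)
        \<le> ennreal C * ennreal_powr (N_norm p \<alpha> (\<lambda>z. f z - f 0)) p)"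
proof -
  define A where "A = ((1 + \<alpha>) / pi + pi / (1 + \<alpha>)) * 2 powr \<bar>\<alpha>\<bar>"
  \<comment> \<open>This is close enough to 1 for the decay \<open>s\<close> to beat the loss
    \<open>q\<close>: their product is
    \<open>2 powr (- ((\<alpha> + 1) * (p + 1) / (2 * p)))\<close>.\<close>
  define l where "l = 2 powr (- (\<alpha> + 1) / (2 * p))"
  define q where "q = l powr (1 - p)"
  define s where "s = 2 powr - (\<alpha> + 1)"
  define K where "K = 64 * 64 * 144 * pi * 4 powr \<bar>\<alpha>\<bar>"
  define b where "b = (1 - l) powr (1 - p) * (4 powr p * (16 / pi))"
  define b' where "b' = 2 powr p * (16 / pi)"
  have "- (\<alpha> + 1) / (2 * p) < 0" using assms by (intro divide_neg_pos) auto
  then have l: "0 < l" "l < 1" unfolding l_def by (auto simp del: minus_add_distrib intro: powr_less_one)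
  have qs: "q * s < 1"
  proof -
    have "q * s = 2 powr (- (\<alpha> + 1) / (2 * p) * (1 - p) + - (\<alpha> + 1))"
      by (simp add: q_def l_def s_def powr_powr flip: powr_add)
    also have "- (\<alpha> + 1) / (2 * p) * (1 - p) + - (\<alpha> + 1) = - ((\<alpha> + 1) * (p + 1) / (2 * p))"
      using assms by (simp add: field_simps)
    also have "2 powr \<dots> < 1" using assms by (intro powr_less_one) auto
    finally show ?thesis .
  qed
  have q: "0 \<le> q" and b: "0 \<le> b" and b': "0 \<le> b'" and A: "0 \<le> A" and K: "0 \<le> K"
    using assms by (simp_all add: q_def b_def b'_def A_def K_def)
  define C\<^sub>1 where "C\<^sub>1 = A * (b * K / (1 - q * s)) * A"
  define C\<^sub>2 where "C\<^sub>2 = A * (b' * K / (1 - q * s)) * A"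
  define C where "C = max 1 (max C\<^sub>1 C\<^sub>2)"
  have "ennreal (inverse C) * ennreal_powr (N_norm p \<alpha> (\<lambda>z. f z - f 0)) p
        \<le> (\<integral>\<^sup>+ z. ennreal (ln (1 + (1 - cmod z) * cmod (deriv f z)) powr p) \<partial>weighted_area \<alpha>) \<and>
      (\<integral>\<^sup>+ z. ennreal (ln (1 + (1 - cmod z) * cmod (deriv f z)) powr p) \<partial>weighted_area \<alpha>)
        \<le> ennreal C * ennreal_powr (N_norm p \<alpha> (\<lambda>z. f z - f 0)) p"
    if "f analytic_on unit_disk" for f
  proof -
    have f: "f holomorphic_on ball 0 1"
      using that analytic_imp_holomorphic by blast
    define u where "u z = ennreal (ln (1 + cmod (f z - f 0)) powr p)" for z
    define v where "v z = ennreal (ln (1 + (1 - cmod z) * cmod (deriv f z)) powr p)" for z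
    have g: "(\<lambda>z. f z - f 0) holomorphic_on ball 0 1" using f by (intro holomorphic_intros)
    have df: "deriv f holomorphic_on ball 0 1" using f by (intro holomorphic_deriv) auto
    have dg: "deriv (\<lambda>z. f z - f 0) z = deriv f z" if "cmod z < 1" for z
    proof (rule DERIV_imp_deriv)
      have "(f has_field_derivative deriv f z) (at z)"
        using that by (intro holomorphic_derivI[OF f]) auto
      then show "((\<lambda>z. f z - f 0) has_field_derivative deriv f z) (at z)"
        by (auto intro!: derivative_eq_intros)
    qed
    have u: "(\<lambda>z. u z * indicator (ball 0 1) z) \<in> borel_measurable borel"
      unfolding u_def using assms
      by (intro borel_measurable_ennreal_indicator_ball continuous_on_ln_one_plus_powr continuous_intros
          holomorphic_on_imp_continuous_on[OF f]) auto
    have v: "(\<lambda>z. v z * indicator (ball 0 1) z) \<in> borel_measurable borel"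
      unfolding v_def using assms
      by (intro borel_measurable_ennreal_indicator_ball continuous_on_ln_one_plus_powr continuous_intros
          holomorphic_on_imp_continuous_on[OF df]) auto
    let ?I = "\<lambda>F. \<integral>\<^sup>+z. F z \<partial>weighted_area \<alpha>" and ?J = "\<lambda>F. \<integral>\<^sup>+z. disk_weight \<alpha> z * F z \<partial>lborel"
    have uv: "?J u \<le> ennreal (b * K / (1 - q * s)) * ?J v"
      unfolding K_def s_def
    proof (rule nn_integral_disk_weight_le_of_hardy_kernel_suminf[OF v b q qs[unfolded s_def]])
      show "u z \<le> (\<Sum>j. ennreal (b * q ^ j) * (\<integral>\<^sup>+w. hardy_kernel j z w * v w \<partial>lborel))" if "cmod z < 1" for z
        unfolding u_def v_def b_def q_def
        by (rule ln_diff_powr_le_hardy_kernel_suminf[OF assms(1) l f that])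
    qed
    have vu: "?J v \<le> ennreal (b' * K / (1 - q * s)) * ?J u"
      unfolding K_def s_def
    proof (rule nn_integral_disk_weight_le_of_hardy_kernel_suminf[OF u b' q qs[unfolded s_def]])
      fix z :: complex
      assume z: "cmod z < 1"
      \<comment> \<open>A single term, at \<open>j = 0\<close>, bounds \<open>v z\<close>; it is
        extended to a series so that the same summation lemma applies.\<close>
      let ?T = "\<lambda>j. ennreal (b' * q ^ j) * (\<integral>\<^sup>+w. hardy_kernel j z w * u w \<partial>lborel)"
      have "v z \<le> ?T 0"
        using ln_deriv_powr_le_hardy_kernel[OF assms(1) g z] by (simp add: u_def v_def b'_def dg[OF z])
      also have "\<dots> = (\<Sum>j<1. ?T j)" by simp
      also have "\<dots> \<le> (\<Sum>j. ?T j)" by (intro sum_le_suminf) auto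
      finally show "v z \<le> (\<Sum>j. ?T j)" .
    qed
    \<comment> \<open>Passing between \<open>weighted_area\<close> and \<open>disk_weight\<close>
      costs a factor \<open>A\<close> on each side.\<close>
    have IJ: "?I G \<le> ennreal (A * c * A) * ?I F"
      if "0 \<le> c" "?J G \<le> ennreal c * ?J F" "(\<lambda>z. G z * indicator (ball 0 1) z) \<in> borel_measurable borel"
        "(\<lambda>z. F z * indicator (ball 0 1) z) \<in> borel_measurable borel" for F G c
    proof -
      have "?I G \<le> ennreal A * ?J G"
        unfolding A_def by (rule nn_integral_weighted_area_bounds(1)[OF assms(2) that(3)])
      also have "\<dots> \<le> ennreal A * (ennreal c * ?J F)" using that(2) by (rule mult_left_mono) simp
      also have "\<dots> \<le> ennreal A * (ennreal c * (ennreal A * ?I F))"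
        unfolding A_def by (intro mult_left_mono nn_integral_weighted_area_bounds(2)[OF assms(2) that(4)]) simp_all
      also have "\<dots> = ennreal (A * c * A) * ?I F"
        using A that(1) by (simp add: ennreal_mult mult.assoc)
      finally show ?thesis .
    qed
    have "?I u \<le> ennreal C\<^sub>1 * ?I v"
      unfolding C\<^sub>1_def using b K qs by (intro IJ uv u v) auto
    also have "\<dots> \<le> ennreal C * ?I v" by (intro mult_right_mono ennreal_leI) (auto simp: C_def)
    finally have "ennreal (inverse C) * ?I u \<le> ennreal (inverse C) * (ennreal C * ?I v)"
      by (rule mult_left_mono) simp
    also have "\<dots> = ?I v"
    proof -
      have "0 < C" by (simp add: C_def)
      then have "ennreal (inverse C) * ennreal C = 1" by (simp flip: ennreal_mult)
      then show ?thesis by (simp flip: mult.assoc)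
    qed
    finally have 1: "ennreal (inverse C) * ?I u \<le> ?I v" .
    have "?I v \<le> ennreal C\<^sub>2 * ?I u"
      unfolding C\<^sub>2_def using b' K qs by (intro IJ vu u v) auto
    also have "\<dots> \<le> ennreal C * ?I u" by (intro mult_right_mono ennreal_leI) (auto simp: C_def)
    finally show ?thesis
      using 1 unfolding ennreal_powr_N_norm[OF assms(1)] u_def v_def by blast
  qed
  moreover have "1 \<le> C" by (simp add: C_def)
  ultimately show ?thesis by blast
qed

end
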